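(* There exist numerical constants $c_0,c_1>0$ such that, for any $G,\rho,\Delta>0$ and any $\epsilon>0$ satisfying $\epsilon^2\le c_0\min\{G^2,\rho\Delta\}$, $$\mathcal T_\epsilon(\mathcal A_{\det},\mathcal F(G,\rho,\Delta))\;\ge\; c_1\,\frac{G^2\min\{\rho\Delta,G^2\}}{\epsilon^4}.$$
   Context: All norms are Euclidean; $\mathbb N=\{0,1,2,\dots\}$; $\inf\varnothing=+\infty$. Function class. A function $f:\mathbb R^d\to\mathbb R$ is $\rho$-weakly convex if $f+\frac{\rho}{2}\|\cdot\|^2$ is convex, and weakly convex if this holds for some $\rho>0$. For $G,\rho,\Delta>0$, $\mathcal F(G,\rho,\Delta)$ is the union over all dimensions $d$ of the sets of functions $f:\mathbb R^d\to\mathbb R$ that are $\rho$-weakly convex, $G$-Lipschitz ($|f(x)-f(y)|\le G\|x-y\|$ for all $x,y$), and satisfy $f(\mathbf 0)-\inf_{x\in\mathbb R^d}f(x)\le\Delta$. Subdifferential. $\partial f(x)$ is the subdifferential of the weakly convex function $f$ at $x$ (all standard notions coincide; e.g. the set of $g$ with $\liminf_{y\to x,\,y\ne x}\frac{f(y)-f(x)-\langle g,y-x\rangle}{\|y-x\|}\ge 0$). Stationarity. The Moreau envelope is $f_{1/(2\rho)}(x):=\min_{z\in\mathbb R^d}\{f(z)+\rho\|x-z\|^2\}$. For $f$ on $\mathbb R^d$ in $\mathcal F(G,\rho,\Delta)$, a point $x$ is $\epsilon$-stationary if $\|\nabla f_{1/(2\rho)}(x)\|\le\epsilon$. Oracle.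 At a query point $x$ the oracle returns the function value and the full subdifferential set, $\mathbb O_f(x)=(f(x),\partial f(x))$. Algorithms. $\mathcal A_{\det}$ is the class of deterministic first-order algorithms: such an algorithm $\mathsf A$ produces, for each weakly convex $f:\mathbb R^d\to\mathbb R$ (in any dimension $d$), queries $x^0=\mathbf 0$ and $x^t=\Gamma_t\big((\mathbb O_f(x^s))_{s<t}\big)\in\mathbb R^d$, $t\ge1$, where the maps $\Gamma_t$ (possibly depending on the dimension $d$) do not otherwise depend on $f$. Write $\mathsf A^{(t)}[f]:=x^t$. Complexity. For a class of algorithms $\mathcal A$ and a class of functions $\mathcal H$, $$\mathcal T_\epsilon(\mathcal A,\mathcal H):=\inf_{\mathsf A\in\mathcal A}\ \sup_{f\in\mathcal H}\ \inf\{t\in\mathbb N : \mathsf A^{(t)}[f]\text{ is an }\epsilon\text{-stationary point of }f\}.$$ *)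

theory Defs
  imports "HOL-Analysis.Analysis" "HOL-Library.Poly_Mapping"
begin

(* The complexity measure takes a supremum over functions on all R^d, so the dimension d has to be
   a term-level natural number. R^d is modelled as a subspace of the inner product space of
   finitely supported functions. *)

instantiation poly_mapping :: (type, real_inner) real_inner
begin

lift_definition scaleR_poly_mapping :: "real \<Rightarrow> ('a \<Rightarrow>\<^sub>0 'b) \<Rightarrow> ('a \<Rightarrow>\<^sub>0 'b)"
  is "\<lambda>c x i. c *\<^sub>R x i"
  by (erule finite_subset[rotated]) auto

definition inner_poly_mapping :: "('a \<Rightarrow>\<^sub>0 'b) \<Rightarrow> ('a \<Rightarrow>\<^sub>0 'b) \<Rightarrow> real" where
  "inner_poly_mapping x y = (\<Sum>i\<in>Poly_Mapping.keys x. Poly_Mapping.lookup x i \<bullet> Poly_Mapping.lookup y i)"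

definition norm_poly_mapping :: "('a \<Rightarrow>\<^sub>0 'b) \<Rightarrow> real" where
  "norm_poly_mapping x = sqrt (x \<bullet> x)"

definition dist_poly_mapping :: "('a \<Rightarrow>\<^sub>0 'b) \<Rightarrow> ('a \<Rightarrow>\<^sub>0 'b) \<Rightarrow> real" where
  "dist_poly_mapping x y = norm (x - y)"

definition sgn_poly_mapping :: "('a \<Rightarrow>\<^sub>0 'b) \<Rightarrow> ('a \<Rightarrow>\<^sub>0 'b)" where
  "sgn_poly_mapping x = inverse (norm x) *\<^sub>R x"

definition uniformity_poly_mapping :: "(('a \<Rightarrow>\<^sub>0 'b) \<times> ('a \<Rightarrow>\<^sub>0 'b)) filter" where
  "uniformity_poly_mapping = (INF e\<in>{0<..}. principal {(x, y). dist x y < e})"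

definition open_poly_mapping :: "('a \<Rightarrow>\<^sub>0 'b) set \<Rightarrow> bool" where
  "open_poly_mapping U \<longleftrightarrow> (\<forall>x\<in>U. \<forall>\<^sub>F (x', y) in uniformity. x' = x \<longrightarrow> y \<in> U)"

instance
proof
  have inner_eq: "x \<bullet> y = (\<Sum>i\<in>A. Poly_Mapping.lookup x i \<bullet> Poly_Mapping.lookup y i)"
    if "finite A" "Poly_Mapping.keys x \<subseteq> A" for A and x y :: "'a \<Rightarrow>\<^sub>0 'b"
    unfolding inner_poly_mapping_def using that
    by (intro sum.mono_neutral_left) (auto simp: in_keys_iff)
  fix x y z :: "'a \<Rightarrow>\<^sub>0 'b" and a b :: real
  let ?A = "Poly_Mapping.keys x \<union> Poly_Mapping.keys y"
  show "a *\<^sub>R (x + y) = a *\<^sub>R x + a *\<^sub>R y"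
    by (rule poly_mapping_eqI)
      (simp add: scaleR_poly_mapping.rep_eq lookup_add scaleR_add_right)
  show "(a + b) *\<^sub>R x = a *\<^sub>R x + b *\<^sub>R x"
    by (rule poly_mapping_eqI)
      (simp add: scaleR_poly_mapping.rep_eq lookup_add scaleR_add_left)
  show "a *\<^sub>R b *\<^sub>R x = (a * b) *\<^sub>R x"
    by (rule poly_mapping_eqI) (simp add: scaleR_poly_mapping.rep_eq)
  show "1 *\<^sub>R x = x"
    by (rule poly_mapping_eqI) (simp add: scaleR_poly_mapping.rep_eq)
  show "x \<bullet> y = y \<bullet> x"
    using inner_eq[of ?A x y] inner_eq[of ?A y x] by (simp add: inner_commute)
  have "Poly_Mapping.keys (x + y) \<subseteq> ?A"
    by (rule keys_add)
  then show "(x + y) \<bullet> z = x \<bullet> z + y \<bullet> z"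
    by (simp add: inner_eq[of ?A] lookup_add inner_add_left sum.distrib)
  have "Poly_Mapping.keys (a *\<^sub>R x) \<subseteq> Poly_Mapping.keys x"
    by (auto simp: in_keys_iff scaleR_poly_mapping.rep_eq)
  then show "a *\<^sub>R x \<bullet> y = a * (x \<bullet> y)"
    by (simp add: inner_eq[of "Poly_Mapping.keys x"] scaleR_poly_mapping.rep_eq sum_distrib_left)
  show "0 \<le> x \<bullet> x"
    by (simp add: inner_poly_mapping_def sum_nonneg)
  show "x \<bullet> x = 0 \<longleftrightarrow> x = 0"
    by (auto simp: inner_poly_mapping_def sum_nonneg_eq_0_iff in_keys_iff intro!: poly_mapping_eqI)
qed (simp_all only: norm_poly_mapping_def dist_poly_mapping_def sgn_poly_mapping_def
      uniformity_poly_mapping_def open_poly_mapping_def)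

end

type_synonym vect = "nat \<Rightarrow>\<^sub>0 real"

definition euclid :: "nat \<Rightarrow> vect set" where
  "euclid d = {x. Poly_Mapping.keys x \<subseteq> {..<d}}"

lemma subspace_euclid: "subspace (euclid d)"
  unfolding subspace_def euclid_def
  by (auto simp: in_keys_iff lookup_add scaleR_poly_mapping.rep_eq subset_iff) (metis add.right_neutral)

lemma inner_euclid:
  assumes "x \<in> euclid d"
  shows "x \<bullet> y = (\<Sum>i<d. Poly_Mapping.lookup x i * Poly_Mapping.lookup y i)"
  unfolding inner_poly_mapping_def using assms
  by (intro sum.mono_neutral_cong_left) (auto simp: euclid_def in_keys_iff)

(* Below, a function on R^d is a pair of d and an f :: vect => real;
   all notions depend only on the values of f on euclid d. *)

definition weakly_convex_with :: "real \<Rightarrow> nat \<Rightarrow> (vect \<Rightarrow> real) \<Rightarrow> bool" where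
  "weakly_convex_with \<rho> d f \<longleftrightarrow> convex_on (euclid d) (\<lambda>x. f x + \<rho> / 2 * (norm x)\<^sup>2)"

definition weakly_convex :: "nat \<Rightarrow> (vect \<Rightarrow> real) \<Rightarrow> bool" where
  "weakly_convex d f \<longleftrightarrow> (\<exists>\<rho>>0. weakly_convex_with \<rho> d f)"

definition fun_class :: "real \<Rightarrow> real \<Rightarrow> real \<Rightarrow> (nat \<times> (vect \<Rightarrow> real)) set" where
  "fun_class G \<rho> \<Delta> = {(d, f). 1 \<le> d \<and> weakly_convex_with \<rho> d f \<and> G-lipschitz_on (euclid d) f \<and>
     bdd_below (f ` euclid d) \<and> f 0 - (INF x\<in>euclid d. f x) \<le> \<Delta>}"

definition subdiff :: "nat \<Rightarrow> (vect \<Rightarrow> real) \<Rightarrow> vect \<Rightarrow> vect set" where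
  "subdiff d f x = {g \<in> euclid d.
     Liminf (at x within euclid d) (\<lambda>y. ereal ((f y - f x - g \<bullet> (y - x)) / norm (y - x))) \<ge> 0}"

(* The Moreau envelope with parameter 1/(2 rho). If f is rho-weakly convex, the minimised function
   is strongly convex in z, so that the infimum is a minimum. *)
definition moreau_env :: "real \<Rightarrow> nat \<Rightarrow> (vect \<Rightarrow> real) \<Rightarrow> vect \<Rightarrow> real" where
  "moreau_env \<rho> d f x = (INF z\<in>euclid d. f z + \<rho> * (norm (x - z))\<^sup>2)"

definition has_gradient :: "nat \<Rightarrow> (vect \<Rightarrow> real) \<Rightarrow> vect \<Rightarrow> vect \<Rightarrow> bool" where
  "has_gradient d F x g \<longleftrightarrow>
     g \<in> euclid d \<and> (F has_derivative (\<lambda>h. g \<bullet> h)) (at x within euclid d)"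

lemma has_gradient_unique:
  assumes "x \<in> euclid d" "has_gradient d F x g" "has_gradient d F x g'"
  shows "g = g'"
proof -
  define w where "w = g - g'"
  have w: "w \<in> euclid d"
    using assms subspace_diff[OF subspace_euclid] by (auto simp: w_def has_gradient_def)
  have line: "x + t *\<^sub>R w \<in> euclid d" for t
    using assms(1) w subspace_add[OF subspace_euclid] subspace_mul[OF subspace_euclid] by blast
  have "((\<lambda>t. F (x + t *\<^sub>R w)) has_derivative (\<lambda>t. k \<bullet> (t *\<^sub>R w))) (at 0)"
    if "has_gradient d F x k" for k
  proof -
    have "((\<lambda>t. x + t *\<^sub>R w) has_derivative (\<lambda>t. t *\<^sub>R w)) (at 0)"
      by (auto intro!: derivative_eq_intros)
    moreover have "(F has_derivative (\<lambda>h. k \<bullet> h))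
        (at (x + 0 *\<^sub>R w) within ((\<lambda>t. x + t *\<^sub>R w) ` UNIV))"
      using that line unfolding has_gradient_def by (auto intro: has_derivative_subset)
    ultimately show ?thesis
      by (rule has_derivative_in_compose)
  qed
  from has_derivative_unique[OF this[OF assms(2)] this[OF assms(3)]]
  have "g \<bullet> w = g' \<bullet> w"
    by (auto dest: fun_cong[of _ _ 1])
  then have "w \<bullet> w = 0"
    by (simp add: w_def inner_diff_left)
  then show ?thesis
    by (simp add: w_def)
qed

definition stationary :: "real \<Rightarrow> real \<Rightarrow> nat \<Rightarrow> (vect \<Rightarrow> real) \<Rightarrow> vect \<Rightarrow> bool" where
  "stationary \<rho> \<epsilon> d f x \<longleftrightarrow> (\<exists>g. has_gradient d (moreau_env \<rho> d f) x g \<and> norm g \<le> \<epsilon>)"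

definition fo_oracle :: "nat \<Rightarrow> (vect \<Rightarrow> real) \<Rightarrow> vect \<Rightarrow> real \<times> vect set" where
  "fo_oracle d f x = (f x, subdiff d f x)"

(* An algorithm A is represented by its iterates: A d f t is the t-th query for f on R^d. *)
type_synonym algorithm = "nat \<Rightarrow> (vect \<Rightarrow> real) \<Rightarrow> nat \<Rightarrow> vect"

definition det_algs :: "algorithm set" where
  "det_algs = {A. \<exists>\<Gamma> :: nat \<Rightarrow> nat \<Rightarrow> (real \<times> vect set) list \<Rightarrow> vect.
     (\<forall>d t os. \<Gamma> d t os \<in> euclid d) \<and>
     (\<forall>d f. weakly_convex d f \<longrightarrow>
        A d f 0 = 0 \<and>
        (\<forall>t\<ge>1. A d f t = \<Gamma> d t (map (\<lambda>s. fo_oracle d f (A d f s)) [0..<t])))}"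

(* In ereal, the infimum over the empty set is infinity. The parameter rho is the one that
   occurs in the notion of stationarity. *)
definition complexity ::
  "real \<Rightarrow> real \<Rightarrow> algorithm set \<Rightarrow> (nat \<times> (vect \<Rightarrow> real)) set \<Rightarrow> ereal" where
  "complexity \<rho> \<epsilon> \<A> \<H> =
     (INF A\<in>\<A>. SUP (d, f)\<in>\<H>. INF t\<in>{t. stationary \<rho> \<epsilon> d f (A d f t)}. ereal (real t))"

end

theory Submission
  imports Defs
begin

text \<open>
  In suitable units the hard function of the coordinates \<open>c j\<close>, \<open>j < N\<close>, is
  \<open>2 (\<Sum>j<N. \<psi> (c j)) + max (- 2 H) (MAX i<N. - H (c i) - (\<Sum>j<i. \<psi> (c j)))\<close> with \<open>H = 8 w\<close>,
  where \<open>\<psi>\<close> is nonincreasing, equal to 1 near 0 and to 0 from 2 on. Near a point with \<open>c j = 0\<close>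
  for all \<open>j \<ge> t\<close> only the pieces \<open>i \<le> t\<close> are visible, so a resisting oracle forces one query per
  coordinate. Since \<open>\<psi>\<close> drops by 1 per coordinate, a piece becomes relevant only when all but \<open>O(w)\<close>
  of the earlier coordinates have been moved away from 0; hence about \<open>w\<close> pieces compete at a time,
  and the minimal norm in the convex hull of their gradients is of order \<open>H / sqrt w\<close>,
  independently of \<open>N\<close>. The curvature of \<open>\<psi>\<close> is spread over the coordinates and costs only a
  constant, and the total decrease is of order \<open>N\<close>. This allows \<open>w\<close> of order \<open>G\<^sup>2 / \<epsilon>\<^sup>2\<close> and \<open>N\<close> of
  order \<open>w \<cdot> min {\<rho> \<Delta>, G\<^sup>2} / \<epsilon>\<^sup>2\<close>, where \<open>N \<le> w\<^sup>2\<close> keeps the function \<open>G\<close>-Lipschitz.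
\<close>

subsection \<open>The one-dimensional profile\<close>

text \<open>Only the parabola between 1 and 2 is concave; the kinks at -1 and 2 are convex. The
  branch \<open>- u\<close> makes very negative coordinates steep as well, so that the coordinates
  of the plateau are bounded below.\<close>

definition profile :: "real \<Rightarrow> real" where
  "profile u = max 0 (1 + max 0 (- 1 - u) - (max 0 (u - 1))\<^sup>2)"

lemma profile_nonneg: "0 \<le> profile u"
  by (simp add: profile_def)

lemma profile_flat: "\<bar>u\<bar> \<le> 1 \<Longrightarrow> profile u = 1"
  by (auto simp: profile_def max_def)

lemma profile_left: "u \<le> - 1 \<Longrightarrow> profile u = - u"
  by (auto simp: profile_def max_def)

lemma profile_middle: "1 \<le> u \<Longrightarrow> u \<le> 2 \<Longrightarrow> profile u = 1 - (u - 1)\<^sup>2"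
  using power_mono[of "u - 1" 1 2] by (auto simp: profile_def max_def)

lemma profile_right: "2 \<le> u \<Longrightarrow> profile u = 0"
proof -
  assume "2 \<le> u"
  then have "1 \<le> (u - 1)\<^sup>2" by (intro one_le_power) simp
  moreover have "max 0 (- 1 - u) = 0" "max 0 (u - 1) = u - 1" using \<open>2 \<le> u\<close> by auto
  ultimately show ?thesis by (simp add: profile_def)
qed

lemmas profile_simps = profile_flat profile_left profile_middle profile_right

lemma profile_cases:
  fixes u :: real
  obtains "u \<le> - 1" | "\<bar>u\<bar> \<le> 1" | "1 \<le> u" "u \<le> 2" | "2 \<le> u"
  by linarith

lemma profile_antimono:
  assumes "u \<le> v" shows "profile v \<le> profile u"
proof -
  have "(max 0 (u - 1))\<^sup>2 \<le> (max 0 (v - 1))\<^sup>2"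
    using assms by (intro power_mono) auto
  then have "1 + max 0 (- 1 - v) - (max 0 (v - 1))\<^sup>2 \<le> 1 + max 0 (- 1 - u) - (max 0 (u - 1))\<^sup>2"
    using assms by linarith
  then show ?thesis by (simp add: profile_def max.coboundedI2)
qed

lemma profile_le_1: "- 1 \<le> u \<Longrightarrow> profile u \<le> 1"
  using profile_antimono[of "- 1" u] by (simp add: profile_simps)

lemma profile_lipschitz: "\<bar>profile u - profile v\<bar> \<le> 2 * \<bar>u - v\<bar>"
proof -
  have "profile u - profile v \<le> 2 * (v - u)" if "u \<le> v" for u v
  proof (cases u rule: profile_cases)
    case 1
    with that show ?thesis
    proof (cases v rule: profile_cases)
      case 3
      have "(v - 1)\<^sup>2 \<le> v - 1" using 3 by (simp add: power2_eq_square mult_left_le)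
      with 1 3 show ?thesis by (simp add: profile_simps)
    qed (simp_all add: profile_simps)
  next
    case 2
    with that show ?thesis
    proof (cases v rule: profile_cases)
      case 3
      have "(v - 1)\<^sup>2 \<le> v - 1" using 3 by (simp add: power2_eq_square mult_left_le)
      with 2 3 show ?thesis by (simp add: profile_simps)
    qed (simp_all add: profile_simps)
  next
    case 3
    show ?thesis
    proof (cases "v \<le> 2")
      case True
      have "(v - 1)\<^sup>2 - (u - 1)\<^sup>2 = (v - u) * (v + u - 2)" by (simp add: power2_eq_square algebra_simps)
      also have "\<dots> \<le> (v - u) * 2" using True 3 that by (intro mult_left_mono) auto
      finally show ?thesis using True 3 that by (simp add: profile_simps)
    next
      case False
      have "1 - (u - 1)\<^sup>2 = (2 - u) * u" by (simp add: power2_eq_square algebra_simps)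
      also have "\<dots> \<le> (2 - u) * 2" using 3 by (intro mult_left_mono) auto
      finally show ?thesis using False 3 by (simp add: profile_simps)
    qed
  next
    case 4
    with that show ?thesis by (simp add: profile_simps)
  qed
  from this[of u v] this[of v u] profile_antimono[of u v] profile_antimono[of v u]
  show ?thesis by (cases "u \<le> v") auto
qed

lemma profile_ge: "1 - (v - 1)\<^sup>2 \<le> profile v"
proof (cases "v \<le> 1")
  case True
  then have "profile 1 \<le> profile v" by (rule profile_antimono)
  then have "1 \<le> profile v" by (simp add: profile_flat)
  then show ?thesis using zero_le_power2[of "v - 1"] by linarith
qed (auto simp: profile_def max_def)

text \<open>This is weak convexity in the form of a supporting parabola. On the curved part the
  parabola is the global minorant \<open>1 - (v - 1)\<^sup>2\<close> itself; elsewhere the slope is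
  -1 or 0.\<close>

lemma profile_support:
  obtains p where "\<And>v. profile v \<ge> profile u + p * (v - u) - (v - u)\<^sup>2"
proof (cases u rule: profile_cases)
  case 1
  have "profile v \<ge> profile u + (- 1) * (v - u) - (v - u)\<^sup>2" for v
  proof (cases "v \<le> 1")
    case True
    then have "- v \<le> profile v"
      by (auto simp: profile_def max_def)
    moreover have "profile u + (- 1) * (v - u) = - v" using 1 by (simp add: profile_left)
    ultimately show ?thesis using zero_le_power2[of "v - u"] by linarith
  next
    case False
    then have "(v - 1)\<^sup>2 \<le> (v - u)\<^sup>2" using 1 by (intro power_mono) auto
    moreover note profile_ge[of v]
    moreover have "profile u + (- 1) * (v - u) = - v" using 1 by (simp add: profile_left)
    ultimately show ?thesis using False by linarith
  qed
  then show ?thesis using that by blast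
next
  case 2
  have "profile v \<ge> profile u + 0 * (v - u) - (v - u)\<^sup>2" for v
  proof (cases "v \<le> 1")
    case True
    then have "profile 1 \<le> profile v" by (rule profile_antimono)
    then have "1 \<le> profile v" by (simp add: profile_flat)
    moreover have "profile u + 0 * (v - u) = 1" using 2 by (simp add: profile_flat)
    ultimately show ?thesis using zero_le_power2[of "v - u"] by linarith
  next
    case False
    then have "(v - 1)\<^sup>2 \<le> (v - u)\<^sup>2" using 2 by (intro power_mono) auto
    moreover note profile_ge[of v]
    moreover have "profile u + 0 * (v - u) = 1" using 2 by (simp add: profile_flat)
    ultimately show ?thesis by linarith
  qed
  then show ?thesis using that by blast
next
  case 3
  have "profile v \<ge> profile u + (- 2 * (u - 1)) * (v - u) - (v - u)\<^sup>2" for v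
  proof -
    have "profile u + (- 2 * (u - 1)) * (v - u) - (v - u)\<^sup>2 = 1 - (v - 1)\<^sup>2"
      using 3 by (simp add: profile_simps power2_eq_square algebra_simps)
    also note profile_ge[of v]
    finally show ?thesis .
  qed
  then show ?thesis using that by blast
next
  case 4
  have "profile v \<ge> profile u + 0 * (v - u) - (v - u)\<^sup>2" for v
    using profile_right[OF 4] profile_nonneg[of v] zero_le_power2[of "v - u"] by linarith
  then show ?thesis using that by blast
qed

text \<open>The parabola has slope -1/2 at 5/4 and gets steeper up to 2, so a step \<open>s\<close>
  inside [5/4, 2] drops by at least \<open>s / 2\<close>; left of -1 the slope is -1. What remains
  is the plateau with a margin, where \<open>profile (5/4) = 15/16\<close> is a lower bound, and the
  end beyond \<open>2 - s\<close>.\<close>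

lemma profile_trichotomy:
  assumes "0 < s" "s \<le> 1/8"
  obtains (steep) "profile (c + s) \<le> profile c - s / 2"
    | (high) "- 9/8 \<le> c" "c \<le> 5/4" "15/16 \<le> profile c"
    | (low) "2 - s \<le> c" "profile c \<le> 2 * s"
proof -
  consider "c \<le> - 1 - s" | "- 1 - s < c" "c \<le> 5/4" | "5/4 \<le> c" "c \<le> 2 - s" | "2 - s \<le> c"
    by linarith
  then show ?thesis
  proof cases
    case 1
    then show ?thesis using assms by (intro steep) (simp add: profile_simps)
  next
    case 2
    have "profile (5/4) \<le> profile c" using 2 by (intro profile_antimono) auto
    moreover have "profile (5/4) = 15/16" by (simp add: profile_simps power2_eq_square)
    ultimately show ?thesis using 2 assms by (intro high) auto
  next
    case 3
    have "profile (c + s) = profile c - s / 2 - 2 * s * (c - 5/4) - s * s"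
      using 3 assms by (simp add: profile_simps power2_eq_square algebra_simps)
    moreover have "0 \<le> 2 * s * (c - 5/4)" "0 \<le> s * s" using assms 3 by auto
    ultimately show ?thesis using steep by linarith
  next
    case 4
    have "profile c \<le> profile (2 - s)" using 4 by (intro profile_antimono) auto
    also have "\<dots> \<le> 2 * s" using assms by (simp add: profile_simps power2_eq_square algebra_simps)
    finally show ?thesis using 4 by (intro low)
  qed
qed

subsection \<open>The hard function in coordinates\<close>

text \<open>The recursion makes the passage from \<open>m\<close> to \<open>Suc m\<close> pieces a
  single \<open>max\<close>. The floor keeps the function bounded below and is low enough to be
  inactive in the second case of \<open>hard_descent\<close>.\<close>

primrec hard_max :: "real \<Rightarrow> nat \<Rightarrow> (nat \<Rightarrow> real) \<Rightarrow> real" where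
  "hard_max H 0 c = - 2 * H"
| "hard_max H (Suc m) c = max (hard_max H m c) (- H * c m - (\<Sum>j<m. profile (c j)))"

text \<open>In the piece of index \<^term>\<open>i\<close> the weight of \<open>profile (c j)\<close> is 1 for \<open>j < i\<close> and 2
  otherwise. It never vanishes, so that moving a coordinate through the steep part of the profile
  decreases all pieces.\<close>

definition hard :: "real \<Rightarrow> nat \<Rightarrow> (nat \<Rightarrow> real) \<Rightarrow> real" where
  "hard H m c = 2 * (\<Sum>j<m. profile (c j)) + hard_max H m c"

lemma hard_max_le_iff:
  "hard_max H m c \<le> y \<longleftrightarrow> - 2 * H \<le> y \<and> (\<forall>i<m. - H * c i - (\<Sum>j<i. profile (c j)) \<le> y)"
  by (induction m) (auto simp: less_Suc_eq)

lemma hard_max_ge_floor: "- 2 * H \<le> hard_max H m c"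
  using hard_max_le_iff by blast

lemma hard_max_ge_piece: "i < m \<Longrightarrow> - H * c i - (\<Sum>j<i. profile (c j)) \<le> hard_max H m c"
  using hard_max_le_iff by blast

lemma hard_max_attained:
  obtains "hard_max H m c = - 2 * H"
    | i where "i < m" "hard_max H m c = - H * c i - (\<Sum>j<i. profile (c j))"
proof (induction m arbitrary: thesis)
  case 0
  then show ?case by simp
next
  case (Suc m)
  show ?case
  proof (cases "hard_max H (Suc m) c = hard_max H m c")
    case True
    show ?thesis
      by (rule Suc.IH) (use Suc.prems True in \<open>auto simp: less_Suc_eq\<close>)
  next
    case False
    then have "hard_max H (Suc m) c = - H * c m - (\<Sum>j<m. profile (c j))" by auto
    then show ?thesis using Suc.prems(2) by blast
  qed
qed

lemma sum_weighted_split: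
  fixes g :: "nat \<Rightarrow> real"
  assumes "i \<le> m"
  shows "(\<Sum>j<m. (if j < i then 1 else 2) * g j) = 2 * (\<Sum>j<m. g j) - (\<Sum>j<i. g j)"
proof -
  have "(\<Sum>j<m. (if j < i then 1 else 2) * g j) = (\<Sum>j<m. 2 * g j - (if j < i then g j else 0))"
    by (intro sum.cong) auto
  also have "(\<Sum>j<m. if j < i then g j else 0) = (\<Sum>j<i. g j)"
    using assms by (intro sum.mono_neutral_cong_right) auto
  ultimately show ?thesis by (simp add: sum_subtractf sum_distrib_left)
qed

text \<open>A piece attaining the maximum at \<open>c\<close> touches \<open>hard\<close> there and
  minorises it everywhere. Weak convexity and the Lipschitz bound thus reduce to one weighted sum of
  profiles with one linear or constant term.\<close>

lemma hard_cases:
  obtains k where "\<And>j. 0 \<le> k j \<and> k j \<le> (2::real)"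
      "hard H m c = (\<Sum>j<m. k j * profile (c j)) - 2 * H"
      "\<And>c'. hard H m c' \<ge> (\<Sum>j<m. k j * profile (c' j)) - 2 * H"
    | k i where "\<And>j. 0 \<le> k j \<and> k j \<le> (2::real)" "i < m"
      "hard H m c = (\<Sum>j<m. k j * profile (c j)) - H * c i"
      "\<And>c'. hard H m c' \<ge> (\<Sum>j<m. k j * profile (c' j)) - H * c' i"
proof (rule hard_max_attained[of H m c])
  assume *: "hard_max H m c = - 2 * H"
  show ?thesis
    by (rule that(1)[of "\<lambda>_. 2"])
      (use * hard_max_ge_floor[of H m] in \<open>auto simp: hard_def sum_distrib_left\<close>)
next
  fix i assume i: "i < m" and *: "hard_max H m c = - H * c i - (\<Sum>j<i. profile (c j))"
  show ?thesis
  proof (rule that(2)[of "\<lambda>j. if j < i then 1 else 2" i])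
    show "hard H m c = (\<Sum>j<m. (if j < i then 1 else 2) * profile (c j)) - H * c i"
      using i * by (simp add: hard_def sum_weighted_split)
    show "hard H m c' \<ge> (\<Sum>j<m. (if j < i then 1 else 2) * profile (c' j)) - H * c' i" for c'
      using i hard_max_ge_piece[OF i, of H c'] by (simp add: hard_def sum_weighted_split)
  qed (use i in auto)
qed

section \<open>Bounds, weak convexity and Lipschitz continuity in coordinates\<close>

lemma hard_lower: "- 2 * H \<le> hard H m c"
  using hard_max_ge_floor[of H m c] sum_nonneg[of "{..<m}" "\<lambda>j. profile (c j)"]
  by (simp add: hard_def profile_nonneg)

lemma hard_zero:
  assumes "0 \<le> H" shows "hard H m (\<lambda>_. 0) \<le> 2 * real m"
proof -
  have "hard_max H m (\<lambda>_. 0) \<le> 0"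
    using assms by (auto simp: hard_max_le_iff profile_flat)
  then show ?thesis by (simp add: hard_def profile_flat)
qed

text \<open>Each profile has weight at most 2 and reads only its own coordinate, so the quadratic
  errors add up to twice the squared distance, with a constant independent of
  \<open>m\<close>.\<close>

lemma hard_support:
  obtains p where
    "\<And>c'. hard H m c' \<ge> hard H m c + (\<Sum>j<m. p j * (c' j - c j)) - 2 * (\<Sum>j<m. (c' j - c j)\<^sup>2)"
proof -
  obtain q where q: "\<And>u v. profile v \<ge> profile u + q u * (v - u) - (v - u)\<^sup>2"
  proof -
    have "\<exists>p. \<forall>v. profile v \<ge> profile u + p * (v - u) - (v - u)\<^sup>2" for u
      by (rule profile_support[of u]) blast
    then show ?thesis using that by metis
  qed
  have weighted: "(\<Sum>j<m. k j * profile (c' j)) \<ge> (\<Sum>j<m. k j * profile (c j))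
      + (\<Sum>j<m. k j * q (c j) * (c' j - c j)) - 2 * (\<Sum>j<m. (c' j - c j)\<^sup>2)"
    if k: "\<And>j. 0 \<le> k j \<and> k j \<le> 2" for k c'
  proof -
    have "k j * profile (c' j) \<ge> k j * profile (c j) + k j * q (c j) * (c' j - c j) - 2 * (c' j - c j)\<^sup>2" for j
    proof -
      have "k j * (profile (c j) + q (c j) * (c' j - c j) - (c' j - c j)\<^sup>2) \<le> k j * profile (c' j)"
        using k q by (intro mult_left_mono) auto
      moreover have "k j * (c' j - c j)\<^sup>2 \<le> 2 * (c' j - c j)\<^sup>2"
        using k by (intro mult_right_mono) auto
      ultimately show ?thesis by (simp add: algebra_simps)
    qed
    then have "(\<Sum>j<m. k j * profile (c' j)) \<ge>
        (\<Sum>j<m. k j * profile (c j) + k j * q (c j) * (c' j - c j) - 2 * (c' j - c j)\<^sup>2)"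
      by (intro sum_mono)
    then show ?thesis
      by (simp add: sum.distrib sum_subtractf sum_distrib_left)
  qed
  show ?thesis
  proof (rule hard_cases[of H m c])
    fix k :: "nat \<Rightarrow> real"
    assume k: "\<And>j. 0 \<le> k j \<and> k j \<le> 2" "hard H m c = (\<Sum>j<m. k j * profile (c j)) - 2 * H"
      "\<And>c'. hard H m c' \<ge> (\<Sum>j<m. k j * profile (c' j)) - 2 * H"
    show ?thesis
      by (rule that[of "\<lambda>j. k j * q (c j)"]) (use k(2) k(3) weighted[of k, OF k(1)] in smt)
  next
    fix k :: "nat \<Rightarrow> real" and i
    assume k: "\<And>j. 0 \<le> k j \<and> k j \<le> 2" "i < m" "hard H m c = (\<Sum>j<m. k j * profile (c j)) - H * c i"
      "\<And>c'. hard H m c' \<ge> (\<Sum>j<m. k j * profile (c' j)) - H * c' i"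
    have lin: "(\<Sum>j<m. (k j * q (c j) - (if j = i then H else 0)) * (c' j - c j))
        = (\<Sum>j<m. k j * q (c j) * (c' j - c j)) - H * (c' i - c i)" for c'
    proof -
      have "(\<Sum>j<m. (if j = i then H else 0) * (c' j - c j)) = H * (c' i - c i)"
        using k(2) by (simp add: if_distrib[of "\<lambda>x. x * _"] cong: if_cong)
      then show ?thesis by (simp add: left_diff_distrib sum_subtractf)
    qed
    have "hard H m c' \<ge> hard H m c + (\<Sum>j<m. (k j * q (c j) - (if j = i then H else 0)) * (c' j - c j))
        - 2 * (\<Sum>j<m. (c' j - c j)\<^sup>2)" for c'
      using lin[of c'] k(3) k(4)[of c'] weighted[of k c', OF k(1)] unfolding right_diff_distrib[of H] by linarith
    then show ?thesis by (rule that)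
  qed
qed

text \<open>The linear term of a piece reads one coordinate, so \<open>H\<close> meets only the
  maximal difference \<open>b\<close>; the profiles, of weight at most 2 and Lipschitz constant 2,
  give the sum of the differences.\<close>

lemma hard_lipschitz:
  assumes "0 \<le> H" "0 \<le> b" "\<And>j. j < m \<Longrightarrow> \<bar>c j - c' j\<bar> \<le> b"
  shows "hard H m c \<le> hard H m c' + H * b + 4 * (\<Sum>j<m. \<bar>c j - c' j\<bar>)"
proof -
  have weighted: "(\<Sum>j<m. k j * profile (c j)) \<le> (\<Sum>j<m. k j * profile (c' j)) + 4 * (\<Sum>j<m. \<bar>c j - c' j\<bar>)"
    if k: "\<And>j. 0 \<le> k j \<and> k j \<le> 2" for k
  proof -
    have "k j * profile (c j) \<le> k j * profile (c' j) + 4 * \<bar>c j - c' j\<bar>" for j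
    proof -
      have "k j * (profile (c j) - profile (c' j)) \<le> k j * (2 * \<bar>c j - c' j\<bar>)"
        using k profile_lipschitz[of "c j" "c' j"] by (intro mult_left_mono) auto
      also have "\<dots> \<le> 2 * (2 * \<bar>c j - c' j\<bar>)"
        using k by (intro mult_right_mono) auto
      finally show ?thesis by (simp add: algebra_simps)
    qed
    then have "(\<Sum>j<m. k j * profile (c j)) \<le> (\<Sum>j<m. k j * profile (c' j) + 4 * \<bar>c j - c' j\<bar>)"
      by (intro sum_mono)
    then show ?thesis by (simp add: sum.distrib sum_distrib_left)
  qed
  show ?thesis
  proof (rule hard_cases[of H m c])
    fix k :: "nat \<Rightarrow> real"
    assume k: "\<And>j. 0 \<le> k j \<and> k j \<le> 2" "hard H m c = (\<Sum>j<m. k j * profile (c j)) - 2 * H"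
      "\<And>c'. hard H m c' \<ge> (\<Sum>j<m. k j * profile (c' j)) - 2 * H"
    have "0 \<le> H * b" using assms by simp
    then show ?thesis using k(2) k(3)[of c'] weighted[of k, OF k(1)] by linarith
  next
    fix k :: "nat \<Rightarrow> real" and i
    assume k: "\<And>j. 0 \<le> k j \<and> k j \<le> 2" "i < m" "hard H m c = (\<Sum>j<m. k j * profile (c j)) - H * c i"
      "\<And>c'. hard H m c' \<ge> (\<Sum>j<m. k j * profile (c' j)) - H * c' i"
    have "H * (c' i - c i) \<le> H * b"
      using assms(1) assms(3)[OF k(2)] by (intro mult_left_mono) auto
    then have "H * c' i \<le> H * c i + H * b" by (simp add: algebra_simps)
    then show ?thesis using k(3) k(4)[of c'] weighted[of k, OF k(1)] by linarith
  qed
qed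

text \<open>Piece \<open>m\<close> subtracts \<open>profile (c (m - 1)) = 1\<close> more than piece
  \<open>m - 1\<close>, which outweighs the difference of the linear terms, so the maximum is
  unchanged. The 2 is \<open>2 * profile (c m)\<close>.\<close>

lemma hard_Suc_eq:
  assumes "0 < m" "\<bar>c m\<bar> \<le> 1" "\<bar>c (m - 1)\<bar> \<le> 1" "H * (c (m - 1) - c m) \<le> 1"
  shows "hard H (Suc m) c = hard H m c + 2"
proof -
  obtain k where m: "m = Suc k" using assms(1) by (cases m) auto
  have "- H * c m - (\<Sum>j<m. profile (c j)) \<le> - H * c k - (\<Sum>j<k. profile (c j))"
    using assms by (simp add: m profile_flat algebra_simps)
  also have "\<dots> \<le> hard_max H m c" using m by (intro hard_max_ge_piece) simp
  finally show ?thesis using assms(2) by (simp add: hard_def profile_flat)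
qed

section \<open>Common descent directions of all relevant pieces\<close>

text \<open>Every profile has weight at least 1 in every piece, and raising coordinates only lowers
  the linear terms; so the total drop of the profiles is a drop of all pieces.\<close>

lemma hard_shift_le:
  assumes "\<And>j. c j \<le> c' j" "0 \<le> b" "0 \<le> H"
    and drop: "b \<le> (\<Sum>j<N. profile (c j) - profile (c' j))"
  shows "hard H N c' \<le> hard H N c - b"
proof -
  have d: "profile (c' j) \<le> profile (c j)" for j by (intro profile_antimono assms)
  have "- H * c' i - (\<Sum>j<i. profile (c' j)) \<le>
      hard H N c - b - 2 * (\<Sum>j<N. profile (c' j))" if "i < N" for i
  proof -
    have "(\<Sum>j<i. profile (c j) - profile (c' j)) \<le> (\<Sum>j<N. profile (c j) - profile (c' j))"
      using that d by (intro sum_mono2) auto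
    moreover have "H * c i \<le> H * c' i" using assms by (intro mult_left_mono) auto
    moreover have "- H * c i - (\<Sum>j<i. profile (c j)) \<le> hard_max H N c"
      using that by (rule hard_max_ge_piece)
    ultimately show ?thesis using drop unfolding hard_def sum_subtractf by linarith
  qed
  moreover have "- 2 * H \<le> hard H N c - b - 2 * (\<Sum>j<N. profile (c' j))"
    using drop hard_max_ge_floor[of H N c] assms(2) unfolding hard_def sum_subtractf by linarith
  ultimately have "hard_max H N c' \<le> hard H N c - b - 2 * (\<Sum>j<N. profile (c' j))"
    unfolding hard_max_le_iff by blast
  then show ?thesis unfolding hard_def by linarith
qed

text \<open>All other elements precede the largest one.\<close>

lemma finite_initial_card_le:
  fixes A :: "nat set"
  assumes "finite A" "\<And>i. i \<in> A \<Longrightarrow> card {j \<in> A. j < i} \<le> n"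
  shows "card A \<le> Suc n"
proof (cases "A = {}")
  case False
  have "A - {Max A} \<subseteq> {j \<in> A. j < Max A}"
    using assms(1) by (auto intro!: le_neq_implies_less)
  then have "card (A - {Max A}) \<le> n"
    using card_mono[of "{j \<in> A. j < Max A}" "A - {Max A}"] assms(1) assms(2)[of "Max A"] False by auto
  then show ?thesis using assms(1) False by (simp add: card_Diff_singleton)
qed simp

text \<open>Either at least \<^term>\<open>w\<close> coordinates lie in the steep part of the profile, and moving \<^term>\<open>w\<close>
  of them decreases all pieces; or all but \<^term>\<open>w\<close> coordinates lie in a flat part. In the second case
  a piece can be nearly maximal only if few flat coordinates of profile 1 precede it, so that the
  nearly maximal pieces are \<open>O(w)\<close> many and moving their coordinates decreases each of them at
  slope \<open>8 w\<close>. Both directions have slope of order \<open>sqrt w\<close> after normalisation.\<close>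

lemma hard_descent:
  fixes w N :: nat
  assumes w: "1 \<le> w" and s: "0 < s" "s \<le> 1/8" "s * real N \<le> real w"
    and k: "k < N" "c k \<le> 5/4"
  obtains W D where "W \<subseteq> {..<N}" "hard (8 * real w) N (\<lambda>j. c j + (if j \<in> W then s else 0)) \<le> hard (8 * real w) N c - s * D"
    "real (card W) \<le> 34 * real w" "real w \<le> 2 * D" "real w * real (card W) \<le> 4 * D\<^sup>2"
proof -
  define H where "H = 8 * real w"
  define T where "T = {j. j < N \<and> profile (c j + s) \<le> profile (c j) - s / 2}"
  have finT: "finite T" by (simp add: T_def)
  show ?thesis
  proof (cases "w \<le> card T")
    case True
    \<comment> \<open>\<open>T\<close> may be much larger; taking just \<open>w\<close> of its
      elements keeps the length of the move at \<open>s * sqrt w\<close>.\<close>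
    then obtain W where W: "W \<subseteq> T" "card W = w" using obtain_subset_with_card_n by metis
    have WN: "W \<subseteq> {..<N}" using W by (auto simp: T_def)
    have "s * (real w / 2) = (\<Sum>j\<in>W. s / 2)" using W by simp
    also have "\<dots> \<le> (\<Sum>j\<in>W. profile (c j) - profile (c j + s))"
      using W(1) by (intro sum_mono) (auto simp: T_def)
    also have "\<dots> = (\<Sum>j<N. profile (c j) - profile (c j + (if j \<in> W then s else 0)))"
      using WN by (intro sum.mono_neutral_cong_left) auto
    finally have "hard H N (\<lambda>j. c j + (if j \<in> W then s else 0)) \<le> hard H N c - s * (real w / 2)"
      using s w by (intro hard_shift_le) (auto simp: H_def)
    then show ?thesis
      by (intro that[OF WN, of "real w / 2"]) (use W in \<open>auto simp: H_def power2_eq_square\<close>)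
  next
    case False
    \<comment> \<open>Coordinates before the first one that is at most 5/4 are steep or have profile
      at most \<open>2 * s\<close>. Since \<open>card T < w\<close> and
      \<open>s * N \<le> w\<close>, piece \<open>i0\<close> subtracts at most \<open>3 * w\<close>
      in profiles, and the maximum is at least \<open>- (8 * 5/4 + 3) * w\<close>.\<close>
    define i0 where "i0 = (LEAST i. c i \<le> 5/4)"
    have i0: "c i0 \<le> 5/4" "i0 \<le> k" using k(2) unfolding i0_def by (auto intro: LeastI Least_le)
    then have i0N: "i0 < N" using k by simp
    have before: "5/4 < c j" if "j < i0" for j
      using not_less_Least[of j "\<lambda>i. c i \<le> 5/4"] that unfolding i0_def by auto
    have "(\<Sum>j<i0. profile (c j)) \<le> (\<Sum>j<i0. (if j \<in> T then 1 else 0) + 2 * s)"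
    proof (intro sum_mono)
      fix j assume "j \<in> {..<i0}"
      then have j: "5/4 < c j" "j < N" using before i0N by auto
      show "profile (c j) \<le> (if j \<in> T then 1 else 0) + 2 * s"
      proof (cases "j \<in> T")
        case True
        then show ?thesis using profile_le_1[of "c j"] j s by simp
      next
        case False
        then show ?thesis
          by (rule_tac profile_trichotomy[of s "c j"]) (use j s in \<open>auto simp: T_def\<close>)
      qed
    qed
    also have "\<dots> = real (card ({..<i0} \<inter> T)) + 2 * s * real i0"
      by (simp add: sum.distrib sum.If_cases)
    also have "\<dots> \<le> real w + 2 * real w"
    proof -
      have "card ({..<i0} \<inter> T) \<le> card T" using finT by (intro card_mono) auto
      moreover have "s * real i0 \<le> s * real N" using i0N s by (intro mult_left_mono) auto
      ultimately show ?thesis using False s(3) by linarith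
    qed
    finally have sum_before: "(\<Sum>j<i0. profile (c j)) \<le> 3 * real w" by simp
    have "H * c i0 \<le> H * (5/4)" using i0(1) by (intro mult_left_mono) (auto simp: H_def)
    then have M: "- 13 * real w \<le> hard_max H N c"
      using hard_max_ge_piece[OF i0N, of H c] sum_before by (simp add: H_def)
    have Hs: "H * s \<le> real w" using s(2) w by (simp add: H_def)
    \<comment> \<open>A piece outside \<open>T \<union> A\<close> already lies \<open>H * s\<close>
      below the maximum, so its coordinate can stay.\<close>
    define A where "A = {i. i < N \<and> i \<notin> T \<and> hard_max H N c - H * s < - H * c i - (\<Sum>j<i. profile (c j))}"
    have finA: "finite A" by (simp add: A_def)
    have A: "15/16 \<le> profile (c i) \<and> (\<Sum>j<i. profile (c j)) \<le> 23 * real w" if "i \<in> A" for i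
    proof -
      have i: "i < N" "i \<notin> T" "hard_max H N c - H * s < - H * c i - (\<Sum>j<i. profile (c j))"
        using that by (auto simp: A_def)
      have S: "0 \<le> (\<Sum>j<i. profile (c j))" by (intro sum_nonneg profile_nonneg)
      \<comment> \<open>14 is 13 from the maximum plus 1 from \<open>H * s\<close>. It forces
        \<open>c i \<le> 7/4\<close>, which excludes the low case; in the high case
        \<open>c i \<ge> - 9/8\<close> yields 14 + 9 = 23.\<close>
      have "H * c i + (\<Sum>j<i. profile (c j)) \<le> 14 * real w" using i(3) M Hs by linarith
      then have *: "8 * (real w * c i) + (\<Sum>j<i. profile (c j)) \<le> 14 * real w" by (simp add: H_def)
      then have "real w * c i \<le> real w * (7/4)" using S by linarith
      then have up: "c i \<le> 7/4" using w by simp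
      show ?thesis
      proof (rule profile_trichotomy[of s "c i"])
        assume "profile (c i + s) \<le> profile (c i) - s / 2"
        then show ?thesis using i by (simp add: T_def)
      next
        assume "- 9/8 \<le> c i" and h: "15/16 \<le> profile (c i)"
        then have "real w * (- 9/8) \<le> real w * c i" by (intro mult_left_mono) auto
        with * h show ?thesis by simp
      qed (use s up in auto)
    qed
    \<comment> \<open>Each element of \<open>A\<close> before \<open>i\<close> contributes at least
      15/16 to a sum of at most \<open>23 * w\<close>, and 23 * 16/15 < 25.\<close>
    have "card A \<le> Suc (25 * w)"
    proof (rule finite_initial_card_le[OF finA])
      fix i assume i: "i \<in> A"
      have "real (card {j \<in> A. j < i}) * (15/16) \<le> (\<Sum>j\<in>{j \<in> A. j < i}. profile (c j))"
        using A by (intro sum_bounded_below) auto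
      also have "\<dots> \<le> (\<Sum>j<i. profile (c j))" by (intro sum_mono2) (auto simp: profile_nonneg)
      also have "\<dots> \<le> 23 * real w" using A i by simp
      finally have "real (card {j \<in> A. j < i}) \<le> real (25 * w)" using w by simp
      then show "card {j \<in> A. j < i} \<le> 25 * w" by (simp only: of_nat_le_iff)
    qed
    then have card: "card (T \<union> A) \<le> 27 * w"
      using card_Un_le[of T A] False w by linarith
    let ?c = "\<lambda>j. c j + (if j \<in> T \<union> A then s else 0)"
    have d: "profile (?c j) \<le> profile (c j)" for j using s by (intro profile_antimono) auto
    have 1: "(\<Sum>j<i. profile (c j) - profile (?c j)) \<le> (\<Sum>j<N. profile (c j) - profile (?c j))"
      if "i < N" for i
      using that d by (intro sum_mono2) auto
    have 2: "0 \<le> (\<Sum>j<N. profile (c j) - profile (?c j))" using d by (intro sum_nonneg) auto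
    have "- H * ?c i - (\<Sum>j<i. profile (?c j)) \<le>
        hard H N c - H * s - 2 * (\<Sum>j<N. profile (?c j))" if i: "i < N" for i
    proof -
      have "- H * ?c i - (\<Sum>j<i. profile (c j)) \<le> hard_max H N c - H * s"
      proof (cases "i \<in> T \<union> A")
        case True
        then show ?thesis using hard_max_ge_piece[OF i, of H c] by (simp add: algebra_simps)
      next
        case False
        then show ?thesis using i by (auto simp: A_def)
      qed
      then show ?thesis using 1[OF i] 2 unfolding hard_def sum_subtractf by linarith
    qed
    \<comment> \<open>The floor is \<open>- 16 * w\<close>, whereas the maximum is at least
      \<open>- 13 * w\<close> and \<open>H * s \<le> w\<close>.\<close>
    moreover have "- 2 * H \<le> hard H N c - H * s - 2 * (\<Sum>j<N. profile (?c j))"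
      using M Hs 2 unfolding hard_def sum_subtractf H_def by linarith
    ultimately have "hard_max H N ?c \<le> hard H N c - H * s - 2 * (\<Sum>j<N. profile (?c j))"
      unfolding hard_max_le_iff by blast
    then have "hard H N ?c \<le> hard H N c - s * H" by (simp add: hard_def mult.commute)
    moreover have "real w * real (card (T \<union> A)) \<le> 4 * H\<^sup>2"
    proof -
      have "real w * real (card (T \<union> A)) \<le> real w * (256 * real w)"
        using card by (intro mult_left_mono) auto
      then show ?thesis by (simp add: H_def power2_eq_square)
    qed
    ultimately show ?thesis
      by (intro that[of "T \<union> A" H]) (use card w in \<open>auto simp: H_def T_def A_def\<close>)
  qed
qed

subsection \<open>Orthonormal sequences\<close>

definition orthonormal_seq :: "nat \<Rightarrow> (nat \<Rightarrow> 'a::real_inner) \<Rightarrow> bool" where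
  "orthonormal_seq m e \<longleftrightarrow> (\<forall>i<m. \<forall>j<m. e i \<bullet> e j = (if i = j then 1 else 0))"

lemma orthonormal_seq_sum_inner:
  assumes "orthonormal_seq m e" "A \<subseteq> {..<m}" "i < m"
  shows "(\<Sum>j\<in>A. a j *\<^sub>R e j) \<bullet> e i = (if i \<in> A then a i else 0)"
proof -
  have "(\<Sum>j\<in>A. a j *\<^sub>R e j) \<bullet> e i = (\<Sum>j\<in>A. if j = i then a j else 0)"
    unfolding inner_sum_left using assms by (intro sum.cong) (auto simp: orthonormal_seq_def)
  also have "\<dots> = (if i \<in> A then a i else 0)"
    using assms(2) finite_subset[OF assms(2)] by simp
  finally show ?thesis .
qed

lemma orthonormal_seq_norm_sum:
  assumes "orthonormal_seq m e" "A \<subseteq> {..<m}"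
  shows "(norm (\<Sum>j\<in>A. a j *\<^sub>R e j))\<^sup>2 = (\<Sum>j\<in>A. (a j)\<^sup>2)"
proof -
  have "(norm (\<Sum>j\<in>A. a j *\<^sub>R e j))\<^sup>2 = (\<Sum>i\<in>A. (\<Sum>j\<in>A. a j *\<^sub>R e j) \<bullet> (a i *\<^sub>R e i))"
    by (simp only: power2_norm_eq_inner inner_sum_right)
  also have "\<dots> = (\<Sum>i\<in>A. (a i)\<^sup>2)"
    using assms(2) by (intro sum.cong)
      (auto simp: orthonormal_seq_sum_inner[OF assms] power2_eq_square subset_iff)
  finally show ?thesis .
qed

lemma bessel_inequality:
  assumes "orthonormal_seq m e"
  shows "(\<Sum>j<m. (e j \<bullet> x)\<^sup>2) \<le> (norm x)\<^sup>2"
proof -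
  let ?p = "\<Sum>j<m. (e j \<bullet> x) *\<^sub>R e j"
  have "?p \<bullet> x = (\<Sum>j<m. (e j \<bullet> x)\<^sup>2)"
    by (simp add: inner_sum_left power2_eq_square)
  moreover have "?p \<bullet> ?p = (\<Sum>j<m. (e j \<bullet> x)\<^sup>2)"
    using orthonormal_seq_norm_sum[OF assms subset_refl] by (simp add: power2_norm_eq_inner)
  moreover have "0 \<le> (x - ?p) \<bullet> (x - ?p)" by simp
  ultimately show ?thesis
    by (simp add: inner_diff inner_commute power2_norm_eq_inner)
qed

lemma sum_abs_inner_le:
  assumes "orthonormal_seq m e"
  shows "(\<Sum>j<m. \<bar>e j \<bullet> x\<bar>) \<le> sqrt (real m) * norm x"
proof -
  let ?u = "\<Sum>j<m. sgn (e j \<bullet> x) *\<^sub>R e j"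
  have "(\<Sum>j<m. \<bar>e j \<bullet> x\<bar>) = ?u \<bullet> x"
    by (simp add: inner_sum_left abs_sgn mult.commute)
  also have "\<dots> \<le> norm ?u * norm x" by (rule norm_cauchy_schwarz)
  also have "\<dots> \<le> sqrt (real m) * norm x"
  proof (intro mult_right_mono real_le_rsqrt)
    have "(norm ?u)\<^sup>2 = (\<Sum>j<m. (sgn (e j \<bullet> x))\<^sup>2)"
      using assms by (intro orthonormal_seq_norm_sum) auto
    also have "\<dots> \<le> (\<Sum>j<m. 1)" by (intro sum_mono) (auto simp: sgn_real_def)
    finally show "(norm ?u)\<^sup>2 \<le> real m" by simp
  qed auto
  finally show ?thesis .
qed

section \<open>Unit vectors orthogonal to finitely many given ones\<close>

lemma single_in_euclid: "i < d \<Longrightarrow> Poly_Mapping.single i a \<in> euclid d"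
  by (auto simp: euclid_def)

lemma inner_single: "Poly_Mapping.single i a \<bullet> x = a * Poly_Mapping.lookup x i" for x :: vect
  by (simp add: inner_poly_mapping_def lookup_single)

lemma independent_single: "independent ((\<lambda>i. Poly_Mapping.single i 1 :: vect) ` {..<d})"
proof (rule pairwise_orthogonal_independent)
  show "pairwise orthogonal ((\<lambda>i. Poly_Mapping.single i 1 :: vect) ` {..<d})"
    by (auto simp: pairwise_def orthogonal_def inner_single lookup_single when_def)
  show "0 \<notin> (\<lambda>i. Poly_Mapping.single i 1 :: vect) ` {..<d}"
    by (auto simp: dest!: arg_cong[of _ _ Poly_Mapping.keys])
qed

text \<open>The \<open>d\<close> standard unit vectors cannot all lie in the span of fewer vectors.
  One outside, minus its projection to the span, is nonzero and can be normalised.\<close>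

lemma exists_unit_orthogonal:
  assumes "finite B" "B \<subseteq> euclid d" "card B < d"
  obtains v where "v \<in> euclid d" "norm v = 1" "\<And>b. b \<in> B \<Longrightarrow> v \<bullet> b = 0"
proof -
  let ?E = "(\<lambda>i. Poly_Mapping.single i 1 :: vect) ` {..<d}"
  obtain C where C: "finite C" "span C = span B" "pairwise orthogonal C"
    using basis_orthogonal[OF assms(1)] by blast
  have cE: "card ?E = d"
    by (subst card_image) (auto intro!: inj_onI dest!: arg_cong[of _ _ Poly_Mapping.keys])
  have "\<not> ?E \<subseteq> span B"
    using independent_span_bound[OF assms(1) independent_single, of d] assms(3) cE by linarith
  then obtain b where b: "b \<in> euclid d" "b \<notin> span B" using single_in_euclid by blast
  \<comment> \<open>Should \<open>C\<close> contain 0, division by zero gives it the coefficient 0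
    and its summand vanishes.\<close>
  define p where "p = (\<Sum>x\<in>C. (x \<bullet> b / (x \<bullet> x)) *\<^sub>R x)"
  have p: "p \<in> span B" unfolding p_def C(2)[symmetric] by (intro span_sum span_scale span_base)
  have "span B \<subseteq> euclid d" using assms(2) subspace_euclid by (simp add: span_minimal)
  then have v: "b - p \<in> euclid d" using p b subspace_diff[OF subspace_euclid] by blast
  have orth: "(b - p) \<bullet> x = 0" if "x \<in> C" for x
  proof -
    have "p \<bullet> x = (\<Sum>y\<in>C. if y = x then x \<bullet> b else 0)"
      unfolding p_def inner_sum_left using C(3) that
      by (intro sum.cong) (auto simp: pairwise_def orthogonal_def)
    then have "p \<bullet> x = b \<bullet> x" using that C(1) by (simp add: inner_commute)
    then show ?thesis by (simp add: inner_diff_left)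
  qed
  have orthB: "(b - p) \<bullet> x = 0" if "x \<in> B" for x
  proof -
    have "x \<in> span C" using that C(2) span_base by blast
    then show ?thesis
      using orthogonal_to_span[of x C "b - p"] orth by (auto simp: orthogonal_def)
  qed
  have "b - p \<noteq> 0" using p b by auto
  then show ?thesis
    by (intro that[of "(b - p) /\<^sub>R norm (b - p)"])
      (use v orthB subspace_scale[OF subspace_euclid] in auto)
qed

subsection \<open>Weak convexity and approximate proximal points\<close>

lemma convex_on_if_support:
  fixes g :: "'a::real_inner \<Rightarrow> real"
  assumes "convex S" and supp: "\<And>x. x \<in> S \<Longrightarrow> \<exists>p. \<forall>y\<in>S. g y \<ge> g x + p \<bullet> (y - x)"
  shows "convex_on S g"
proof (rule convex_onI)
  fix t x y assume t: "0 < t" "t < (1::real)" and xy: "x \<in> S" "y \<in> S"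
  let ?w = "(1 - t) *\<^sub>R x + t *\<^sub>R y"
  have "?w \<in> S" using assms(1) t xy by (auto simp: convex_alt)
  then obtain p where p: "\<And>y. y \<in> S \<Longrightarrow> g y \<ge> g ?w + p \<bullet> (y - ?w)" using supp by blast
  have "(1 - t) * (g ?w + p \<bullet> (x - ?w)) + t * (g ?w + p \<bullet> (y - ?w)) \<le> (1 - t) * g x + t * g y"
    using t p xy by (intro add_mono mult_left_mono) auto
  moreover have "(1 - t) * (g ?w + p \<bullet> (x - ?w)) + t * (g ?w + p \<bullet> (y - ?w)) = g ?w"
    by (simp add: algebra_simps)
  ultimately show "g ?w \<le> (1 - t) * g x + t * g y" by simp
qed (rule assms)

text \<open>For an almost minimal \<open>z\<close> the envelope lies below the parabola of
  \<open>z\<close> and nearly touches it at \<open>x\<close>, so its gradient is close to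
  \<open>2 * \<rho> * (x - z)\<close>. Allowing a gap of \<open>\<epsilon>\<close> between the two
  bounds \<open>norm (x - z)\<close>. Almost minimal points avoid a proof that the minimum is
  attained.\<close>

lemma stationary_imp_approx_prox:
  assumes "0 < \<rho>" "0 < \<epsilon>" "x \<in> euclid d" "bdd_below (f ` euclid d)"
    and "stationary \<rho> \<epsilon> d f x" and "0 < \<eta>"
  obtains z where "z \<in> euclid d" "norm (x - z) \<le> \<epsilon> / \<rho>"
    "\<And>y. y \<in> euclid d \<Longrightarrow> f z + \<rho> * (norm (x - z))\<^sup>2 \<le> f y + \<rho> * (norm (x - y))\<^sup>2 + \<eta>"
proof -
  let ?m = "moreau_env \<rho> d f"
  obtain g where g: "g \<in> euclid d" "norm g \<le> \<epsilon>" "(?m has_derivative (\<lambda>h. g \<bullet> h)) (at x within euclid d)"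
    using assms(5) by (auto simp: stationary_def has_gradient_def)
  have bdd: "bdd_below ((\<lambda>z. f z + \<rho> * (norm (y - z))\<^sup>2) ` euclid d)" for y
  proof -
    obtain B where "\<And>z. z \<in> euclid d \<Longrightarrow> B \<le> f z" using assms(4) by (auto simp: bdd_below_def)
    then show ?thesis using assms(1) by (intro bdd_belowI[of _ B]) (auto intro!: add_increasing2)
  qed
  have env_le: "?m y \<le> f z + \<rho> * (norm (y - z))\<^sup>2" if "z \<in> euclid d" for y z
    unfolding moreau_env_def using that by (intro cINF_lower bdd)
  obtain \<delta> where \<delta>: "0 < \<delta>" "\<And>y. y \<in> euclid d \<Longrightarrow> norm (y - x) < \<delta> \<Longrightarrow>
      norm (?m y - ?m x - g \<bullet> (y - x)) \<le> \<epsilon> / 3 * norm (y - x)"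
  proof -
    have "\<forall>e>0. \<exists>\<delta>>0. \<forall>y\<in>euclid d. norm (y - x) < \<delta> \<longrightarrow>
        norm (?m y - ?m x - g \<bullet> (y - x)) \<le> e * norm (y - x)"
      using g(3) unfolding has_derivative_within_alt by blast
    from this[rule_format, of "\<epsilon> / 3"] assms(2) show ?thesis using that by auto
  qed
  \<comment> \<open>Each of the errors \<open>\<theta>\<close>, \<open>\<rho> * t\<^sup>2\<close>
    and \<open>\<epsilon> / 3 * t\<close> becomes at most a third of
    \<open>t * \<epsilon>\<close>.\<close>
  define t where "t = min (\<delta> / 2) (\<epsilon> / (3 * \<rho>))"
  have t: "0 < t" "t < \<delta>" "\<rho> * t \<le> \<epsilon> / 3"
    using assms \<delta>(1) by (auto simp: t_def min_def field_simps)
  define \<theta> where "\<theta> = min \<eta> (t * \<epsilon> / 3)"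
  have \<theta>: "0 < \<theta>" "\<theta> \<le> \<eta>" "\<theta> \<le> t * \<epsilon> / 3" using t assms by (auto simp: \<theta>_def)
  have "\<exists>z\<in>euclid d. f z + \<rho> * (norm (x - z))\<^sup>2 < ?m x + \<theta>"
  proof -
    have "euclid d \<noteq> {}" using assms(3) by blast
    then show ?thesis
      using cINF_less_iff[of "euclid d" "\<lambda>z. f z + \<rho> * (norm (x - z))\<^sup>2" "?m x + \<theta>"] bdd \<theta>(1)
      by (simp add: moreau_env_def)
  qed
  then obtain z where z: "z \<in> euclid d" "f z + \<rho> * (norm (x - z))\<^sup>2 < ?m x + \<theta>" by blast
  define u where "u = g - (2 * \<rho>) *\<^sub>R (x - z)"
  have u: "u \<in> euclid d"
    unfolding u_def using g(1) z(1) assms(3)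
    by (intro subspace_diff[OF subspace_euclid] subspace_scale[OF subspace_euclid])
  have "norm u \<le> \<epsilon>"
  proof (cases "u = 0")
    case False
    define h where "h = (t / norm u) *\<^sub>R u"
    have nh: "norm h = t" using False t(1) by (simp add: h_def)
    have xh: "x + h \<in> euclid d"
      unfolding h_def using u assms(3)
      by (intro subspace_add[OF subspace_euclid] subspace_scale[OF subspace_euclid])
    have "g \<bullet> h \<le> ?m (x + h) - ?m x + \<epsilon> / 3 * t"
    proof -
      have "\<bar>?m (x + h) - ?m x - g \<bullet> h\<bar> \<le> \<epsilon> / 3 * t"
        using \<delta>(2)[OF xh] nh t(2) by simp
      then show ?thesis by linarith
    qed
    also have "?m (x + h) \<le> f z + \<rho> * (norm (x + h - z))\<^sup>2" using z(1) by (rule env_le)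
    also have "(norm (x + h - z))\<^sup>2 = (norm (x - z))\<^sup>2 + 2 * ((x - z) \<bullet> h) + t\<^sup>2"
      unfolding nh[symmetric] power2_norm_eq_inner by (simp add: inner_simps inner_commute)
    finally have "g \<bullet> h \<le> \<theta> + 2 * \<rho> * ((x - z) \<bullet> h) + \<rho> * t\<^sup>2 + \<epsilon> / 3 * t"
      using z(2) by (simp add: algebra_simps)
    then have "u \<bullet> h \<le> \<theta> + \<rho> * t\<^sup>2 + \<epsilon> / 3 * t" by (simp add: u_def inner_diff_left)
    also have "u \<bullet> h = t * norm u"
      using False by (simp add: h_def dot_square_norm power2_eq_square)
    also have "\<rho> * t\<^sup>2 \<le> \<epsilon> / 3 * t"
      unfolding power2_eq_square mult.assoc[symmetric] using t by (intro mult_right_mono) auto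
    finally have "t * norm u \<le> t * \<epsilon>" using \<theta>(3) by (simp add: mult.commute)
    then show ?thesis using t(1) by simp
  qed (use assms in simp)
  have "2 * \<rho> * norm (x - z) = norm (g - u)" using assms(1) by (simp add: u_def)
  also have "\<dots> \<le> \<epsilon> + \<epsilon>" using norm_triangle_ineq4[of g u] g(2) \<open>norm u \<le> \<epsilon>\<close> by linarith
  finally have "norm (x - z) \<le> \<epsilon> / \<rho>" using assms(1) by (simp add: field_simps)
  moreover have "f z + \<rho> * (norm (x - z))\<^sup>2 \<le> f y + \<rho> * (norm (x - y))\<^sup>2 + \<eta>"
    if "y \<in> euclid d" for y
    using env_le[OF that, of x] z(2) \<theta>(2) by linarith
  ultimately show ?thesis using that z(1) by blast
qed

subsection \<open>The hard function on Euclidean space\<close>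

text \<open>The summand \<open>2 (N - m)\<close> stands for the coordinates not yet introduced, whose profile is 1 at
  the queries made so far.\<close>

definition hard_fun :: "real \<Rightarrow> real \<Rightarrow> real \<Rightarrow> nat \<Rightarrow> nat \<Rightarrow> (nat \<Rightarrow> vect) \<Rightarrow> vect \<Rightarrow> real" where
  "hard_fun \<rho> \<tau> H N m e x = \<rho> * \<tau>\<^sup>2 / 4 * (hard H m (\<lambda>j. e j \<bullet> x / \<tau>) + 2 * (real N - real m))"

lemma hard_cong:
  assumes "\<And>j. j < m \<Longrightarrow> c j = c' j"
  shows "hard H m c = hard H m c'"
proof -
  have "n \<le> m \<Longrightarrow> hard_max H n c = hard_max H n c'" for n
    by (induction n) (auto simp: assms)
  then show ?thesis using assms by (simp add: hard_def)
qed

text \<open>By Bessel, the error in \<open>hard_support\<close> is at most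
  \<open>2 / \<tau>\<^sup>2\<close> times the squared distance; the prefactor
  \<open>\<rho> * \<tau>\<^sup>2 / 4\<close> turns this into \<open>\<rho> / 2\<close>, which the
  added quadratic compensates.\<close>

lemma weakly_convex_with_hard_fun:
  assumes "0 < \<rho>" "0 < \<tau>" "orthonormal_seq m e"
  shows "weakly_convex_with \<rho> d (hard_fun \<rho> \<tau> H N m e)"
  unfolding weakly_convex_with_def
proof (rule convex_on_if_support)
  show "convex (euclid d)" by (rule subspace_imp_convex[OF subspace_euclid])
  fix x assume "x \<in> euclid d"
  let ?f = "hard_fun \<rho> \<tau> H N m e"
  obtain p where p: "\<And>c'. hard H m c' \<ge> hard H m (\<lambda>j. e j \<bullet> x / \<tau>)
      + (\<Sum>j<m. p j * (c' j - e j \<bullet> x / \<tau>)) - 2 * (\<Sum>j<m. (c' j - e j \<bullet> x / \<tau>)\<^sup>2)"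
    using hard_support[of H m "\<lambda>j. e j \<bullet> x / \<tau>"] by blast
  let ?q = "(\<rho> * \<tau> / 4) *\<^sub>R (\<Sum>j<m. p j *\<^sub>R e j) + \<rho> *\<^sub>R x"
  have "?f y + \<rho> / 2 * (norm y)\<^sup>2 \<ge> ?f x + \<rho> / 2 * (norm x)\<^sup>2 + ?q \<bullet> (y - x)" for y
  proof -
    let ?A = "\<Sum>j<m. p j * (e j \<bullet> (y - x))" and ?B = "\<Sum>j<m. (e j \<bullet> (y - x))\<^sup>2"
    have "(\<Sum>j<m. p j * (e j \<bullet> y / \<tau> - e j \<bullet> x / \<tau>)) = ?A / \<tau>"
      by (simp add: sum_divide_distrib inner_diff_right flip: diff_divide_distrib)
    moreover have "(\<Sum>j<m. (e j \<bullet> y / \<tau> - e j \<bullet> x / \<tau>)\<^sup>2) = ?B / \<tau>\<^sup>2"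
      by (simp add: sum_divide_distrib inner_diff_right power_divide flip: diff_divide_distrib)
    ultimately have "hard H m (\<lambda>j. e j \<bullet> y / \<tau>) \<ge>
        hard H m (\<lambda>j. e j \<bullet> x / \<tau>) + ?A / \<tau> - 2 * (?B / \<tau>\<^sup>2)"
      using p[of "\<lambda>j. e j \<bullet> y / \<tau>"] by simp
    then have "\<rho> * \<tau>\<^sup>2 / 4 * (hard H m (\<lambda>j. e j \<bullet> x / \<tau>) + ?A / \<tau> - 2 * (?B / \<tau>\<^sup>2) + 2 * (real N - real m)) \<le> ?f y"
      unfolding hard_fun_def using assms(1) by (intro mult_left_mono) auto
    moreover have "\<rho> * \<tau>\<^sup>2 / 4 * (hard H m (\<lambda>j. e j \<bullet> x / \<tau>) + ?A / \<tau> - 2 * (?B / \<tau>\<^sup>2) + 2 * (real N - real m))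
        = ?f x + \<rho> * \<tau> / 4 * ?A - \<rho> / 2 * ?B"
      using assms(2) by (simp add: hard_fun_def field_simps power2_eq_square)
    moreover have "\<rho> / 2 * ?B \<le> \<rho> / 2 * (norm (y - x))\<^sup>2"
      using bessel_inequality[OF assms(3)] assms(1) by (intro mult_left_mono) auto
    moreover have "?q \<bullet> (y - x) = \<rho> * \<tau> / 4 * ?A + \<rho> * (x \<bullet> (y - x))"
      by (simp add: inner_add_left inner_sum_left)
    moreover have "\<rho> / 2 * (norm y)\<^sup>2 = \<rho> / 2 * (norm x)\<^sup>2 + \<rho> * (x \<bullet> (y - x)) + \<rho> / 2 * (norm (y - x))\<^sup>2"
      by (simp add: power2_norm_eq_inner inner_diff inner_commute algebra_simps)
    ultimately show ?thesis by linarith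
  qed
  then show "\<exists>p. \<forall>y\<in>euclid d. ?f y + \<rho> / 2 * (norm y)\<^sup>2 \<ge> ?f x + \<rho> / 2 * (norm x)\<^sup>2 + p \<bullet> (y - x)"
    by blast
qed

lemma lipschitz_on_hard_fun:
  assumes "0 < \<rho>" "0 < \<tau>" "0 \<le> H" "orthonormal_seq m e"
    and G: "\<rho> * \<tau> / 4 * (H + 4 * sqrt (real m)) \<le> G"
  shows "G-lipschitz_on S (hard_fun \<rho> \<tau> H N m e)"
proof (rule lipschitz_onI)
  show "0 \<le> G" using assms by (intro order.trans[OF _ G]) auto
  have le: "hard_fun \<rho> \<tau> H N m e x - hard_fun \<rho> \<tau> H N m e y \<le> G * norm (x - y)" for x y
  proof -
    let ?c = "\<lambda>x j. e j \<bullet> x / \<tau>"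
    have diff: "\<bar>?c x j - ?c y j\<bar> = \<bar>e j \<bullet> (x - y)\<bar> / \<tau>" for j
      using assms(2) by (simp add: inner_diff_right flip: diff_divide_distrib)
    have "\<bar>e j \<bullet> (x - y)\<bar> \<le> norm (x - y)" if "j < m" for j
    proof -
      have "norm (e j) = 1" using assms(4) that by (simp add: orthonormal_seq_def norm_eq_sqrt_inner)
      then show ?thesis using Cauchy_Schwarz_ineq2[of "e j" "x - y"] by simp
    qed
    then have "hard H m (?c x) \<le> hard H m (?c y) + H * (norm (x - y) / \<tau>) + 4 * (\<Sum>j<m. \<bar>?c x j - ?c y j\<bar>)"
      using assms by (intro hard_lipschitz) (auto simp: diff intro!: divide_right_mono)
    also have "(\<Sum>j<m. \<bar>?c x j - ?c y j\<bar>) \<le> sqrt (real m) * norm (x - y) / \<tau>"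
      unfolding diff sum_divide_distrib[symmetric] using assms
      by (intro divide_right_mono sum_abs_inner_le) auto
    finally have "hard H m (?c x) - hard H m (?c y) \<le> (H + 4 * sqrt (real m)) * norm (x - y) / \<tau>"
      using assms(2) by (simp add: field_simps)
    then have "\<rho> * \<tau>\<^sup>2 / 4 * (hard H m (?c x) - hard H m (?c y)) \<le>
        \<rho> * \<tau>\<^sup>2 / 4 * ((H + 4 * sqrt (real m)) * norm (x - y) / \<tau>)"
      using assms(1) by (intro mult_left_mono) auto
    also have "\<dots> = \<rho> * \<tau> / 4 * (H + 4 * sqrt (real m)) * norm (x - y)"
      using assms(2) by (simp add: power2_eq_square)
    also have "\<dots> \<le> G * norm (x - y)" using G by (intro mult_right_mono) auto
    finally show ?thesis by (simp add: hard_fun_def algebra_simps)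
  qed
  show "dist (hard_fun \<rho> \<tau> H N m e x) (hard_fun \<rho> \<tau> H N m e y) \<le> G * dist x y" for x y
    using le[of x y] le[of y x] by (simp add: dist_norm norm_minus_commute abs_le_iff)
qed

lemma hard_fun_lower:
  assumes "0 < \<rho>" shows "- (\<rho> * \<tau>\<^sup>2 / 2 * H) \<le> hard_fun \<rho> \<tau> H N N e x"
proof -
  have "\<rho> * \<tau>\<^sup>2 / 4 * (- 2 * H) \<le> hard_fun \<rho> \<tau> H N N e x"
    unfolding hard_fun_def using assms hard_lower by (intro mult_left_mono) auto
  then show ?thesis by (simp add: algebra_simps)
qed

text \<open>Stationarity gives an almost proximal point \<open>z\<close> close to \<open>x\<close>.
  As \<open>w\<close> coordinates of \<open>x\<close> vanish, \<open>z\<close> is too close for all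
  its coordinates to exceed 5/4, so \<open>hard_descent\<close> applies at \<open>z\<close>; the
  decrease it yields exceeds the growth of the quadratic penalty.\<close>

lemma hard_fun_not_stationary:
  fixes w N :: nat
  assumes "0 < \<rho>" "0 < \<epsilon>" and w: "1 \<le> w" "w \<le> N" and \<tau>: "\<tau> = 32 * \<epsilon> / (\<rho> * sqrt (real w))"
    and e: "orthonormal_seq N e" "\<And>j. j < N \<Longrightarrow> e j \<in> euclid d"
    and x: "x \<in> euclid d" "\<And>j. N - w \<le> j \<Longrightarrow> j < N \<Longrightarrow> e j \<bullet> x = 0"
  shows "\<not> stationary \<rho> \<epsilon> d (hard_fun \<rho> \<tau> (8 * real w) N N e) x"
proof
  let ?H = "8 * real w"
  let ?f = "hard_fun \<rho> \<tau> ?H N N e"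
  assume "stationary \<rho> \<epsilon> d ?f x"
  have \<tau>0: "0 < \<tau>" using assms by simp
  have \<epsilon>: "\<epsilon> = \<rho> * \<tau> * sqrt (real w) / 32" using assms by simp
  \<comment> \<open>Here 2176 = 34 * 64, so that \<open>s * card W \<le> w / 64\<close>. In units of
    \<open>s * \<rho> * \<tau>\<^sup>2\<close> the second-order term and the tolerance
    \<open>\<eta>\<close> then cost \<open>w / 64\<close> each.\<close>
  define s where "s = 1 / (2176 * real N)"
  have N: "1 \<le> real N" "real w \<le> real N" "1 \<le> real w" using w by linarith+
  have s: "0 < s" "s \<le> 1 / 2176" "s * real N \<le> real w"
    using N by (auto simp: s_def field_simps)
  define \<eta> where "\<eta> = s * (\<rho> * \<tau>\<^sup>2 * real w / 64)"
  have "0 < \<eta>" using s N assms(1) \<tau>0 by (auto simp: \<eta>_def)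
  moreover have "bdd_below (?f ` euclid d)"
    using hard_fun_lower[OF assms(1)] by (intro bdd_belowI2)
  ultimately obtain z where z: "z \<in> euclid d" "norm (x - z) \<le> \<epsilon> / \<rho>"
    "\<And>y. y \<in> euclid d \<Longrightarrow> ?f z + \<rho> * (norm (x - z))\<^sup>2 \<le> ?f y + \<rho> * (norm (x - y))\<^sup>2 + \<eta>"
    using stationary_imp_approx_prox[OF assms(1,2) x(1) _ \<open>stationary \<rho> \<epsilon> d ?f x\<close>, of \<eta>] by blast
  have "\<epsilon> / \<rho> = \<tau> * sqrt (real w) / 32" using assms(1) by (simp add: \<epsilon>)
  with z(2) have xz: "norm (x - z) \<le> \<tau> * sqrt (real w) / 32" by simp
  let ?c = "\<lambda>j. e j \<bullet> z / \<tau>"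
  have "\<exists>k<N. ?c k \<le> 5/4"
  proof (rule ccontr)
    assume none: "\<not> (\<exists>k<N. ?c k \<le> 5/4)"
    let ?K = "{N - w..<N}"
    let ?u = "\<Sum>j\<in>?K. 1 *\<^sub>R e j"
    have "(norm ?u)\<^sup>2 = (\<Sum>j\<in>?K. 1\<^sup>2)" by (rule orthonormal_seq_norm_sum[OF e(1)]) auto
    then have nu: "norm ?u = sqrt (real w)" using w by (intro real_sqrt_unique[symmetric]) auto
    have "real w * \<tau> = (\<Sum>j\<in>?K. \<tau>)" using w by simp
    also have "\<dots> \<le> (\<Sum>j\<in>?K. e j \<bullet> (z - x))"
    proof (intro sum_mono)
      fix j assume j: "j \<in> ?K"
      then have "5/4 < e j \<bullet> z / \<tau>" using none by (auto simp: not_le)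
      then have "5/4 * \<tau> < e j \<bullet> z" using \<tau>0 by (simp add: field_simps)
      then show "\<tau> \<le> e j \<bullet> (z - x)" using x(2) j \<tau>0 by (simp add: inner_diff_right)
    qed
    also have "\<dots> = ?u \<bullet> (z - x)" by (simp add: inner_sum_left)
    also have "\<dots> \<le> norm ?u * norm (z - x)" by (rule norm_cauchy_schwarz)
    also have "\<dots> \<le> sqrt (real w) * (\<tau> * sqrt (real w) / 32)"
      unfolding nu using xz by (intro mult_left_mono) (auto simp: norm_minus_commute)
    also have "\<dots> = real w * \<tau> / 32" by simp
    finally show False using N \<tau>0 by (simp add: field_simps)
  qed
  then obtain k where k: "k < N" "?c k \<le> 5/4" by blast
  have s8: "s \<le> 1/8" using s(2) by simp
  obtain W D where W: "W \<subseteq> {..<N}"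
      "hard ?H N (\<lambda>j. ?c j + (if j \<in> W then s else 0)) \<le> hard ?H N ?c - s * D"
      "real (card W) \<le> 34 * real w" "real w \<le> 2 * D" "real w * real (card W) \<le> 4 * D\<^sup>2"
    by (rule hard_descent[where c = ?c, OF w(1) s(1) s8 s(3) k])
  let ?u = "\<Sum>j\<in>W. 1 *\<^sub>R e j"
  let ?y = "z + (s * \<tau>) *\<^sub>R ?u"
  have "?u \<in> euclid d"
    using W(1) e(2) by (intro subspace_sum[OF subspace_euclid]) auto
  then have y: "?y \<in> euclid d"
    using z(1) by (intro subspace_add[OF subspace_euclid] subspace_scale[OF subspace_euclid])
  have "(norm ?u)\<^sup>2 = (\<Sum>j\<in>W. 1\<^sup>2)" by (rule orthonormal_seq_norm_sum[OF e(1) W(1)])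
  then have nu2: "(norm ?u)\<^sup>2 = real (card W)" by simp
  have "hard ?H N (\<lambda>j. e j \<bullet> ?y / \<tau>) = hard ?H N (\<lambda>j. ?c j + (if j \<in> W then s else 0))"
  proof (rule hard_cong)
    fix j assume "j < N"
    then have "e j \<bullet> ?u = (if j \<in> W then 1 else 0)"
      using orthonormal_seq_sum_inner[OF e(1) W(1), of j "\<lambda>_. 1"] by (simp add: inner_commute)
    then show "e j \<bullet> ?y / \<tau> = ?c j + (if j \<in> W then s else 0)"
      using \<tau>0 by (simp add: inner_add_right add_divide_distrib)
  qed
  then have "\<rho> * \<tau>\<^sup>2 / 4 * hard ?H N (\<lambda>j. e j \<bullet> ?y / \<tau>) \<le> \<rho> * \<tau>\<^sup>2 / 4 * (hard ?H N ?c - s * D)"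
    using W(2) assms(1) by (intro mult_left_mono) auto
  then have "?f ?y \<le> ?f z - \<rho> * \<tau>\<^sup>2 / 4 * (s * D)"
    by (simp add: hard_fun_def right_diff_distrib)
  moreover have "(norm (x - ?y))\<^sup>2 = (norm (x - z))\<^sup>2 - 2 * (s * \<tau>) * ((x - z) \<bullet> ?u) + (s * \<tau>)\<^sup>2 * real (card W)"
    unfolding nu2[symmetric] power2_norm_eq_inner
    by (simp add: inner_simps inner_commute power2_eq_square algebra_simps)
  \<comment> \<open>The slope bound \<open>sqrt (w * card W) \<le> 2 * D\<close> limits the
    first-order growth of the penalty to half of the decrease \<open>D / 4\<close>, in the same
    units.\<close>
  moreover have "- (2 * (s * \<tau>) * ((x - z) \<bullet> ?u)) \<le> s * \<tau>\<^sup>2 * D / 8"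
  proof -
    have "- ((x - z) \<bullet> ?u) \<le> norm (x - z) * norm ?u"
      using Cauchy_Schwarz_ineq2[of "x - z" ?u] by linarith
    also have "\<dots> \<le> \<tau> * sqrt (real w) / 32 * norm ?u"
      using xz by (intro mult_right_mono) auto
    also have "\<dots> = \<tau> / 32 * sqrt (real w * real (card W))"
      by (simp add: nu2[symmetric] real_sqrt_mult)
    also have "\<dots> \<le> \<tau> / 32 * (2 * D)"
      using W(4,5) \<tau>0 by (intro mult_left_mono real_le_lsqrt) (auto simp: power_mult_distrib)
    finally have "2 * (s * \<tau>) * (- ((x - z) \<bullet> ?u)) \<le> 2 * (s * \<tau>) * (\<tau> / 32 * (2 * D))"
      using s \<tau>0 by (intro mult_left_mono) auto
    then show ?thesis by (simp add: power2_eq_square algebra_simps)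
  qed
  moreover have "(s * \<tau>)\<^sup>2 * real (card W) \<le> s * \<tau>\<^sup>2 * (real w / 64)"
  proof -
    have "s * real (card W) \<le> (1 / 2176) * (34 * real w)"
      using s W(3) by (intro mult_mono) auto
    then have "(s * \<tau>\<^sup>2) * (s * real (card W)) \<le> (s * \<tau>\<^sup>2) * (real w / 64)"
      using s by (intro mult_left_mono) auto
    then show ?thesis by (simp add: power2_eq_square algebra_simps)
  qed
  ultimately have "?f z + \<rho> * (norm (x - z))\<^sup>2 \<le> ?f z - \<rho> * \<tau>\<^sup>2 / 4 * (s * D)
      + \<rho> * ((norm (x - z))\<^sup>2 + s * \<tau>\<^sup>2 * D / 8 + s * \<tau>\<^sup>2 * (real w / 64)) + \<eta>"
    using z(3)[OF y] mult_left_mono[of "(norm (x - ?y))\<^sup>2"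
        "(norm (x - z))\<^sup>2 + s * \<tau>\<^sup>2 * D / 8 + s * \<tau>\<^sup>2 * (real w / 64)" \<rho>] assms(1)
    by linarith
  then have "(s * \<rho> * \<tau>\<^sup>2) * (D / 8) \<le> (s * \<rho> * \<tau>\<^sup>2) * (real w / 32)"
    by (simp add: \<eta>_def algebra_simps)
  then have "D / 8 \<le> real w / 32"
    using s assms(1) \<tau>0 by (subst (asm) mult_le_cancel_left_pos) auto
  then show False using W(4) N by linarith
qed

subsection \<open>The resisting oracle\<close>

text \<open>At \<open>x\<close> the inequalities needed for \<open>hard_Suc_eq\<close> hold
  strictly, hence also nearby. The additional 2 there cancels against the change of
  \<open>2 * (N - m)\<close>.\<close>

lemma eventually_hard_fun_Suc_eq:
  assumes "0 < \<tau>" "0 < m" "e (m - 1) \<bullet> x = 0" "e m \<bullet> x = 0"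
  shows "\<forall>\<^sub>F y in nhds x. hard_fun \<rho> \<tau> H N (Suc m) e y = hard_fun \<rho> \<tau> H N m e y"
proof -
  have lim: "((\<lambda>y. e j \<bullet> y / \<tau>) \<longlongrightarrow> e j \<bullet> x / \<tau>) (nhds x)" for j
    by (intro tendsto_intros filterlim_ident) (use assms in auto)
  have "((\<lambda>y. H * (e (m - 1) \<bullet> y / \<tau> - e m \<bullet> y / \<tau>)) \<longlongrightarrow> H * (e (m - 1) \<bullet> x / \<tau> - e m \<bullet> x / \<tau>)) (nhds x)"
    by (intro tendsto_intros lim)
  then have "\<forall>\<^sub>F y in nhds x. H * (e (m - 1) \<bullet> y / \<tau> - e m \<bullet> y / \<tau>) < 1"
    by (rule order_tendstoD) (use assms in simp)
  moreover have "\<forall>\<^sub>F y in nhds x. \<bar>e j \<bullet> y / \<tau>\<bar> < 1" if "e j \<bullet> x = 0" for j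
    using tendsto_rabs[OF lim[of j]] by (rule order_tendstoD) (simp add: that)
  note this[of "m - 1", OF assms(3)] this[of m, OF assms(4)]
  ultimately show ?thesis
  proof eventually_elim
    case (elim y)
    then show ?case
      using assms(2) by (simp add: hard_fun_def hard_Suc_eq)
  qed
qed

lemma fo_oracle_cong:
  assumes "\<forall>\<^sub>F y in nhds x. f y = g y"
  shows "fo_oracle d f x = fo_oracle d g x"
proof -
  have "f x = g x" using assms by (rule eventually_nhds_x_imp_x)
  moreover have "\<forall>\<^sub>F y in at x within euclid d. f y = g y"
    using assms by (rule filter_leD[OF at_within_le_nhds])
  then have "Liminf (at x within euclid d) (\<lambda>y. ereal ((f y - f x - v \<bullet> (y - x)) / norm (y - x)))
      = Liminf (at x within euclid d) (\<lambda>y. ereal ((g y - g x - v \<bullet> (y - x)) / norm (y - x)))" for v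
    by (intro Liminf_eq) (auto elim!: eventually_mono simp: \<open>f x = g x\<close>)
  ultimately show ?thesis by (simp add: fo_oracle_def subdiff_def)
qed

lemma det_algs_in_euclid:
  assumes "A \<in> det_algs" "weakly_convex d f"
  shows "A d f t \<in> euclid d"
proof -
  obtain \<Gamma> :: "nat \<Rightarrow> nat \<Rightarrow> (real \<times> vect set) list \<Rightarrow> vect"
    where "\<And>d t os. \<Gamma> d t os \<in> euclid d" "A d f 0 = 0"
      "\<And>t. 1 \<le> t \<Longrightarrow> A d f t = \<Gamma> d t (map (\<lambda>s. fo_oracle d f (A d f s)) [0..<t])"
    using assms unfolding det_algs_def by blast
  then show ?thesis
    using subspace_0[OF subspace_euclid] by (cases "t = 0") (auto simp: Suc_le_eq)
qed

text \<open>A query depends on strictly earlier answers, and an answer only on the function near its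
  query point. So agreement near the queries before \<open>t\<close> fixes query \<open>t\<close>
  too.\<close>

lemma det_algs_query_cong:
  assumes A: "A \<in> det_algs" "weakly_convex d f" "weakly_convex d g"
    and eq: "\<And>s. s < t \<Longrightarrow> \<forall>\<^sub>F y in nhds (A d f s). g y = f y"
    and "s \<le> t"
  shows "A d g s = A d f s"
  using \<open>s \<le> t\<close>
proof (induction s rule: less_induct)
  case (less s)
  obtain \<Gamma> :: "nat \<Rightarrow> nat \<Rightarrow> (real \<times> vect set) list \<Rightarrow> vect"
    where \<Gamma>: "\<And>f. weakly_convex d f \<Longrightarrow> A d f 0 = 0"
      "\<And>f t. weakly_convex d f \<Longrightarrow> 1 \<le> t \<Longrightarrow>
        A d f t = \<Gamma> d t (map (\<lambda>s. fo_oracle d f (A d f s)) [0..<t])"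
    using A(1) unfolding det_algs_def by blast
  show ?case
  proof (cases "s = 0")
    case False
    have "map (\<lambda>r. fo_oracle d g (A d g r)) [0..<s] = map (\<lambda>r. fo_oracle d f (A d f r)) [0..<s]"
      using less eq by (auto intro!: fo_oracle_cong)
    then show ?thesis using False by (simp only: \<Gamma>(2)[OF A(2)] \<Gamma>(2)[OF A(3)] Suc_le_eq neq0_conv One_nat_def)
  qed (simp add: A \<Gamma>(1))
qed

text \<open>The new direction is orthogonal to all earlier queries and to the next one. The oracle answers
  to the earlier queries therefore stay the same, hence so does the next query.\<close>

lemma resisting_directions:
  assumes A: "A \<in> det_algs" and "0 < \<rho>" "0 < \<tau>" and "m \<le> N"
  shows "\<exists>e. orthonormal_seq m e \<and> (\<forall>j<m. e j \<in> euclid (2 * N)) \<and>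
    (\<forall>j<m. \<forall>s\<le>j. e j \<bullet> A (2 * N) (hard_fun \<rho> \<tau> H N m e) s = 0)"
  using \<open>m \<le> N\<close>
proof (induction m)
  case 0
  show ?case by (simp add: orthonormal_seq_def)
next
  case (Suc m)
  let ?d = "2 * N"
  let ?f = "hard_fun \<rho> \<tau> H N"
  have wc: "orthonormal_seq k e \<Longrightarrow> weakly_convex ?d (?f k e)" for k e
    using weakly_convex_with_hard_fun assms by (auto simp: weakly_convex_def)
  obtain e where e: "orthonormal_seq m e" "\<And>j. j < m \<Longrightarrow> e j \<in> euclid ?d"
    "\<And>j s. j < m \<Longrightarrow> s \<le> j \<Longrightarrow> e j \<bullet> A ?d (?f m e) s = 0"
    using Suc by auto
  \<comment> \<open>These are \<open>m\<close> directions and \<open>m + 1\<close> queries;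
    \<open>2 * m + 1 < 2 * N\<close> is why dimension \<open>2 * N\<close> is enough.\<close>
  let ?B = "e ` {..<m} \<union> A ?d (?f m e) ` {..m}"
  have "card ?B \<le> m + Suc m"
    using card_Un_le[of "e ` {..<m}" "A ?d (?f m e) ` {..m}"] card_image_le[of "{..<m}" e]
      card_image_le[of "{..m}" "A ?d (?f m e)"] by simp
  then have "card ?B < ?d" using Suc.prems by simp
  moreover have "?B \<subseteq> euclid ?d" using e(2) det_algs_in_euclid[OF A wc[OF e(1)]] by blast
  ultimately obtain v where v: "v \<in> euclid ?d" "norm v = 1" "\<And>b. b \<in> ?B \<Longrightarrow> v \<bullet> b = 0"
    using exists_unit_orthogonal[of ?B] by auto
  define e' where "e' = e(m := v)"
  have "v \<bullet> v = 1" using v(2) by (simp add: norm_eq_1)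
  moreover have ve: "v \<bullet> e j = 0" "e j \<bullet> v = 0" if "j < m" for j
    using v(3)[of "e j"] that by (auto simp: inner_commute)
  ultimately have e': "orthonormal_seq (Suc m) e'"
    using e(1) ve by (auto simp: orthonormal_seq_def e'_def less_Suc_eq)
  have fm: "?f m e' = ?f m e"
    by (rule ext) (auto simp: hard_fun_def e'_def intro!: hard_cong)
  \<comment> \<open>Before query \<open>m\<close> both \<open>e' (m - 1)\<close> and
    \<open>v\<close> are orthogonal to the queries, so the new piece is invisible there. Query
    \<open>m\<close> itself is covered because \<open>v\<close> is orthogonal to it as well.\<close>
  have same: "A ?d (?f (Suc m) e') s = A ?d (?f m e) s" if "s \<le> m" for s
  proof (rule det_algs_query_cong[OF A wc[OF e(1)] wc[OF e'] _ that])
    fix s assume s: "s < m"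
    have "e' (m - 1) \<bullet> A ?d (?f m e) s = 0" "e' m \<bullet> A ?d (?f m e) s = 0"
      using s e(3)[of "m - 1" s] v(3) by (auto simp: e'_def)
    then show "\<forall>\<^sub>F y in nhds (A ?d (?f m e) s). ?f (Suc m) e' y = ?f m e y"
      unfolding fm[symmetric] using s assms by (intro eventually_hard_fun_Suc_eq) (auto simp: fm)
  qed
  have "e' j \<bullet> A ?d (?f (Suc m) e') s = 0" if "j < Suc m" "s \<le> j" for j s
    using that e(3) v(3) same[of s] by (auto simp: e'_def less_Suc_eq)
  moreover have "\<forall>j<Suc m. e' j \<in> euclid ?d"
    using e(2) v(1) by (auto simp: e'_def less_Suc_eq)
  ultimately show ?case using e' by blast
qed

section \<open>The lower bound and the choice of parameters\<close>

text \<open>Take \<open>N = w * n\<close> resisting directions. Queries before \<open>N - w\<close>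
  are orthogonal to the last \<open>w\<close> of them, hence not stationary. The bounds on
  \<open>w\<close> and \<open>n\<close> are the Lipschitz and the decrease budget.\<close>

lemma complexity_lower:
  fixes w n :: nat
  assumes "0 < G" "0 < \<rho>" "0 < \<epsilon>" and w: "1 \<le> w" "9216 * \<epsilon>\<^sup>2 * real w \<le> G\<^sup>2"
    and n: "1 \<le> n" "n \<le> w" "4608 * \<epsilon>\<^sup>2 * real n \<le> \<rho> * \<Delta>"
  shows "complexity \<rho> \<epsilon> det_algs (fun_class G \<rho> \<Delta>) \<ge> ereal (real (w * n - w))"
  unfolding complexity_def
proof (rule INF_greatest)
  fix A assume A: "A \<in> det_algs"
  define N where "N = w * n"
  define \<tau> where "\<tau> = 32 * \<epsilon> / (\<rho> * sqrt (real w))"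
  let ?H = "8 * real w"
  let ?d = "2 * N"
  have N: "w \<le> N" "1 \<le> N" "N \<le> w * w" using w(1) n by (auto simp: N_def)
  have \<tau>: "0 < \<tau>" using assms by (simp add: \<tau>_def)
  obtain e where e: "orthonormal_seq N e" "\<And>j. j < N \<Longrightarrow> e j \<in> euclid ?d"
    "\<And>j s. j < N \<Longrightarrow> s \<le> j \<Longrightarrow> e j \<bullet> A ?d (hard_fun \<rho> \<tau> ?H N N e) s = 0"
    using resisting_directions[OF A assms(2) \<tau>, of N N ?H] by auto
  let ?f = "hard_fun \<rho> \<tau> ?H N N e"
  have wc: "weakly_convex_with \<rho> ?d ?f"
    using assms \<tau> e(1) by (intro weakly_convex_with_hard_fun)
  have "G-lipschitz_on (euclid ?d) ?f"
  proof (rule lipschitz_on_hard_fun[OF assms(2) \<tau> _ e(1)])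
    \<comment> \<open>\<open>n \<le> w\<close> enters here: the profiles contribute no more than the
      order of \<open>H\<close> to the Lipschitz constant.\<close>
    have "sqrt (real N) \<le> real w"
      using N(3) by (intro real_le_lsqrt) (auto simp: power2_eq_square simp flip: of_nat_mult)
    then have "\<rho> * \<tau> / 4 * (?H + 4 * sqrt (real N)) \<le> \<rho> * \<tau> / 4 * (12 * real w)"
      using assms(2) \<tau> by (intro mult_left_mono) auto
    also have "\<dots> = 96 * \<epsilon> * (real w / sqrt (real w))"
      using assms(2) by (simp add: \<tau>_def)
    also have "\<dots> = 96 * \<epsilon> * sqrt (real w)" by (simp add: real_div_sqrt)
    also have "\<dots> \<le> G"
    proof (rule power2_le_imp_le)
      show "(96 * \<epsilon> * sqrt (real w))\<^sup>2 \<le> G\<^sup>2" using w(2) by (simp add: power_mult_distrib)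
    qed (use assms(1) in simp)
    finally show "\<rho> * \<tau> / 4 * (?H + 4 * sqrt (real N)) \<le> G" .
  qed simp
  moreover have "bdd_below (?f ` euclid ?d)"
    using hard_fun_lower[OF assms(2)] by (intro bdd_belowI2)
  moreover have "?f 0 - (INF x\<in>euclid ?d. ?f x) \<le> \<Delta>"
  proof -
    have "euclid ?d \<noteq> {}" using subspace_0[OF subspace_euclid] by blast
    then have "- (\<rho> * \<tau>\<^sup>2 / 2 * ?H) \<le> (INF x\<in>euclid ?d. ?f x)"
      using hard_fun_lower[OF assms(2)] by (intro cINF_greatest)
    moreover have "?f 0 \<le> \<rho> * \<tau>\<^sup>2 / 4 * (2 * real N)"
      unfolding hard_fun_def using hard_zero[of ?H N] assms(2) by (intro mult_left_mono) auto
    ultimately have "?f 0 - (INF x\<in>euclid ?d. ?f x) \<le> \<rho> * \<tau>\<^sup>2 / 4 * (2 * real N + 16 * real w)"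
      by (simp add: algebra_simps)
    also have "\<dots> \<le> \<rho> * \<tau>\<^sup>2 / 4 * (18 * real N)"
      using N(1) assms(2) by (intro mult_left_mono) auto
    also have "\<dots> = 4608 * \<epsilon>\<^sup>2 * real n / \<rho>"
      using assms(2) w(1) by (simp add: \<tau>_def N_def power_divide power_mult_distrib field_simps power2_eq_square)
    also have "\<dots> \<le> \<Delta>" using n(3) assms(2) by (simp add: field_simps)
    finally show ?thesis .
  qed
  ultimately have mem: "(?d, ?f) \<in> fun_class G \<rho> \<Delta>"
    using wc N(2) by (simp add: fun_class_def)
  have "ereal (real (w * n - w)) \<le> (INF t\<in>{t. stationary \<rho> \<epsilon> ?d ?f (A ?d ?f t)}. ereal (real t))"
  proof (rule INF_greatest, rule ccontr)
    fix t assume t: "t \<in> {t. stationary \<rho> \<epsilon> ?d ?f (A ?d ?f t)}" "\<not> ereal (real (w * n - w)) \<le> ereal (real t)"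
    have "\<not> stationary \<rho> \<epsilon> ?d ?f (A ?d ?f t)"
    proof (rule hard_fun_not_stationary[OF assms(2,3) w(1) N(1) \<tau>_def e(1,2)])
      have "weakly_convex ?d ?f" using wc assms(2) by (auto simp: weakly_convex_def)
      then show "A ?d ?f t \<in> euclid ?d" by (rule det_algs_in_euclid[OF A])
      show "e j \<bullet> A ?d ?f t = 0" if "N - w \<le> j" "j < N" for j
        using t(2) that by (intro e(3)) (auto simp: N_def)
    qed
    with t(1) show False by simp
  qed
  then show "ereal (real (w * n - w)) \<le>
      (SUP (d, f)\<in>fun_class G \<rho> \<Delta>. INF t\<in>{t. stationary \<rho> \<epsilon> d f (A d f t)}. ereal (real t))"
    using mem by (intro SUP_upper2[of "(?d, ?f)"]) auto
qed

theorem theorem3p2: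
  shows "\<exists>c0 > (0::real). \<exists>c1 > (0::real). \<forall>G > (0::real). \<forall>\<rho> > (0::real). \<forall>\<Delta> > (0::real). \<forall>\<epsilon> > (0::real).
    \<epsilon>\<^sup>2 \<le> c0 * min (G\<^sup>2) (\<rho> * \<Delta>) \<longrightarrow>
    complexity \<rho> \<epsilon> det_algs (fun_class G \<rho> \<Delta>) \<ge> ereal (c1 * (G\<^sup>2 * min (\<rho> * \<Delta>) (G\<^sup>2) / \<epsilon> ^ 4))"
proof (intro exI conjI allI impI)
  fix G \<rho> \<Delta> \<epsilon> :: real
  assume pos: "0 < G" "0 < \<rho>" "0 < \<Delta>" "0 < \<epsilon>" and \<epsilon>: "\<epsilon>\<^sup>2 \<le> 1 / 18432 * min (G\<^sup>2) (\<rho> * \<Delta>)"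
  define M where "M = min (\<rho> * \<Delta>) (G\<^sup>2)"
  \<comment> \<open>The common denominator gives \<open>b \<le> a\<close>, hence
    \<open>n \<le> w\<close>. The condition on \<open>\<epsilon>\<close> gives
    \<open>2 \<le> b\<close>, so that rounding down and passing to \<open>n - 1\<close> lose only
    constant factors.\<close>
  define a where "a = G\<^sup>2 / (9216 * \<epsilon>\<^sup>2)"
  define b where "b = M / (9216 * \<epsilon>\<^sup>2)"
  have "18432 * \<epsilon>\<^sup>2 \<le> M" using \<epsilon> by (simp add: M_def min.commute)
  then have ab: "2 \<le> b" "b \<le> a"
    using pos by (auto simp: a_def b_def M_def field_simps)
  define w where "w = nat \<lfloor>a\<rfloor>"
  define n where "n = nat \<lfloor>b\<rfloor>"
  have floor: "2 \<le> \<lfloor>a\<rfloor>" "2 \<le> \<lfloor>b\<rfloor>" using ab by (simp_all add: le_floor_iff)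
  then have w: "real w \<le> a" "a < real w + 1" "2 \<le> real w" unfolding w_def by linarith+
  have n: "real n \<le> b" "b < real n + 1" "2 \<le> real n" using floor unfolding n_def by linarith+
  have nw: "n \<le> w" using ab unfolding w_def n_def by (intro nat_mono floor_mono)
  have "9216 * \<epsilon>\<^sup>2 * real w \<le> 9216 * \<epsilon>\<^sup>2 * a" using w by (intro mult_left_mono) auto
  then have 1: "9216 * \<epsilon>\<^sup>2 * real w \<le> G\<^sup>2" using pos by (simp add: a_def)
  have "4608 * \<epsilon>\<^sup>2 * real n \<le> 9216 * \<epsilon>\<^sup>2 * b" using n by (intro mult_mono) auto
  also have "\<dots> = M" using pos by (simp add: b_def)
  finally have 2: "4608 * \<epsilon>\<^sup>2 * real n \<le> \<rho> * \<Delta>" by (simp add: M_def)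
  have "1 / (8 * 9216\<^sup>2) * (G\<^sup>2 * M / \<epsilon> ^ 4) = (a / 2) * (b / 4)"
    using pos by (simp add: a_def b_def field_simps power2_eq_square power4_eq_xxxx)
  also have "\<dots> \<le> real w * (real n / 2)" using w n ab by (intro mult_mono) auto
  also have "\<dots> \<le> real w * (real n - 1)" using n by (intro mult_left_mono) auto
  also have "\<dots> = real (w * n - w)" using n w by (simp add: of_nat_diff algebra_simps)
  finally have "ereal (1 / (8 * 9216\<^sup>2) * (G\<^sup>2 * M / \<epsilon> ^ 4)) \<le> ereal (real (w * n - w))" by simp
  also have "\<dots> \<le> complexity \<rho> \<epsilon> det_algs (fun_class G \<rho> \<Delta>)"
    using pos 1 2 nw w n by (intro complexity_lower) auto
  finally show "complexity \<rho> \<epsilon> det_algs (fun_class G \<rho> \<Delta>) \<ge>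
      ereal (1 / (8 * 9216\<^sup>2) * (G\<^sup>2 * min (\<rho> * \<Delta>) (G\<^sup>2) / \<epsilon> ^ 4))"
    by (simp add: M_def)
qed simp_all

end
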